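(* Let $a>1$, $b>1$, $v(x)=(1+x^2)^{a/2}$ and $w(\xi)=(1+\xi^2)^{b/2}$. Let $m$ be an integer with $2\le m<b$ and suppose $$a>\frac12+\frac{m(2b-1)}{2(b-m)}.$$ Let $f\colon\mathbb{R}\to\mathbb{C}$ satisfy $f\in\mathcal{F}_{v,m}$ and $\hat f\in\mathcal{F}_w$, and let $p\ge1$. Choose $$\alpha=\frac{2(b-m)(a-\frac12)}{m(2b-1)},\qquad\mu(x)=C_\alpha(1+x^2)^{-\alpha/2},\qquad\Omega=M^{m/b},$$ and let $\tilde f$ be the approximation of $\hat f$ built from $M$ samples with density $\mu$ and frequency truncation $\Omega$. Then the $L_p$-error $E_p=\left(\int_{\mathbb{R}}|\hat f(\xi)-\tilde f(\xi)|^p\,\mathrm{d}\xi\right)^{1/p}$ satisfies, as $M\to\infty$, $$E_p=\mathcal{O}\left(M^{-m+\frac{m}{pb}}\right).$$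
   Context: The Fourier transform is $\hat f(\xi)=\int_{\mathbb{R}}f(x)\mathrm{e}^{-2\pi\mathrm{i}x\xi}\,\mathrm{d}x$. For a weight $v\colon\mathbb{R}\to(0,\infty)$ and $m\in\mathbb{N}_0$, $\|f\|_{\mathcal{F}_v}=\sup_{x\in\mathbb{R}}|f(x)|v(x)$ and $$\|f\|_{\mathcal{F}_{v,m}}=\sup_{x\in\mathbb{R}}\left(\sum_{\ell=0}^m|f^{(\ell)}(x)|(1+|x|^2)^{\ell/2}\right)v(x);$$ $\mathcal{F}_v$ (resp. $\mathcal{F}_{v,m}$) is the set of continuous functions (resp. $m$ times continuously differentiable functions) on $\mathbb{R}$ for which the corresponding norm is finite. The density constant is $C_\alpha=\frac{\Gamma(\alpha/2)}{\sqrt\pi\,\Gamma((\alpha-1)/2)}$; the lower bound on $a$ is equivalent to $\alpha>1$. With $\Psi(x)=\int_{-\infty}^x\mu(t)\,\mathrm{d}t$, $M\in\mathbb{N}$ and nodes $x_j=\Psi^{-1}\left(\frac{2j-1}{2M}\right)$, $j=1,\ldots,M$, the approximation is $$\tilde f(\xi)=\begin{cases}\frac1M\sum_{j=1}^M\frac{f(x_j)}{\mu(x_j)}\,\mathrm{e}^{-2\pi\mathrm{i}\xi x_j}&\text{if }|\xi|\le\Omega,\\0&\text{otherwise.}\end{cases}$$ *)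

theory Defs
  imports "HOL-Analysis.Analysis" "HOL-Library.Landau_Symbols"
begin

definition fourier :: "(real \<Rightarrow> complex) \<Rightarrow> real \<Rightarrow> complex" where
  "fourier f \<xi> = (LINT x|lborel. f x * exp (- (2 * of_real pi * \<i> * of_real x * of_real \<xi>)))"

definition nth_deriv :: "nat \<Rightarrow> (real \<Rightarrow> complex) \<Rightarrow> real \<Rightarrow> complex" where
  "nth_deriv l f = ((\<lambda>g x. vector_derivative g (at x)) ^^ l) f"

definition cont_diff :: "nat \<Rightarrow> (real \<Rightarrow> complex) \<Rightarrow> bool" where
  "cont_diff m f \<longleftrightarrow>
     (\<forall>l<m. \<forall>x. nth_deriv l f differentiable (at x)) \<and> continuous_on UNIV (nth_deriv m f)"

text \<open>The norms take values in the extended nonnegative reals, so that finiteness is a genuine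
  condition; weights are positive throughout.\<close>

definition norm_F :: "(real \<Rightarrow> real) \<Rightarrow> (real \<Rightarrow> complex) \<Rightarrow> ennreal" where
  "norm_F v f = (SUP x. ennreal (norm (f x) * v x))"

definition space_F :: "(real \<Rightarrow> real) \<Rightarrow> (real \<Rightarrow> complex) set" where
  "space_F v = {f. continuous_on UNIV f \<and> norm_F v f < \<infinity>}"

definition norm_Fm :: "(real \<Rightarrow> real) \<Rightarrow> nat \<Rightarrow> (real \<Rightarrow> complex) \<Rightarrow> ennreal" where
  "norm_Fm v m f =
     (SUP x. ennreal ((\<Sum>l\<le>m. norm (nth_deriv l f x) * (1 + \<bar>x\<bar>\<^sup>2) powr (real l / 2)) * v x))"

definition space_Fm :: "(real \<Rightarrow> real) \<Rightarrow> nat \<Rightarrow> (real \<Rightarrow> complex) set" where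
  "space_Fm v m = {f. cont_diff m f \<and> norm_Fm v m f < \<infinity>}"

definition C_const :: "real \<Rightarrow> real" where
  "C_const \<alpha> = Gamma (\<alpha> / 2) / (sqrt pi * Gamma ((\<alpha> - 1) / 2))"

definition distr_fun :: "(real \<Rightarrow> real) \<Rightarrow> real \<Rightarrow> real" where
  "distr_fun \<mu> x = (LINT t:{..x}|lborel. \<mu> t)"

text \<open>For an integrable positive density of total mass one, \<open>distr_fun \<mu>\<close> is a bijection from the
  real line onto the open unit interval, so the inverse below is only used on its range.\<close>

definition node :: "(real \<Rightarrow> real) \<Rightarrow> nat \<Rightarrow> nat \<Rightarrow> real" where
  "node \<mu> M j = inv (distr_fun \<mu>) ((2 * real j - 1) / (2 * real M))"

definition approx_ft ::
    "(real \<Rightarrow> real) \<Rightarrow> real \<Rightarrow> nat \<Rightarrow> (real \<Rightarrow> complex) \<Rightarrow> real \<Rightarrow> complex" where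
  "approx_ft \<mu> \<Omega> M f \<xi> =
     (if \<bar>\<xi>\<bar> \<le> \<Omega> then
        1 / of_nat M * (\<Sum>j=1..M. f (node \<mu> M j) / of_real (\<mu> (node \<mu> M j))
          * exp (- (2 * of_real pi * \<i> * of_real \<xi> * of_real (node \<mu> M j))))
      else 0)"

text \<open>The Bochner integral is 0 for non-integrable functions, so the value of \<open>Lp_error\<close> is
  meaningful only together with \<open>Lp_error_finite\<close>.\<close>

definition Lp_error :: "real \<Rightarrow> (real \<Rightarrow> complex) \<Rightarrow> (real \<Rightarrow> complex) \<Rightarrow> real" where
  "Lp_error p g h = (LINT \<xi>|lborel. norm (g \<xi> - h \<xi>) powr p) powr (1 / p)"

definition Lp_error_finite :: "real \<Rightarrow> (real \<Rightarrow> complex) \<Rightarrow> (real \<Rightarrow> complex) \<Rightarrow> bool" where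
  "Lp_error_finite p g h \<longleftrightarrow> integrable lborel (\<lambda>\<xi>. norm (g \<xi> - h \<xi>) powr p)"

end

(* Substituting x = Psi^(-1)(t) makes the sum a midpoint rule for the integral over (0,1) of f/mu times a
   character. By Poisson summation its error is the sum over k <> 0 of oscillatory integrals of f(x)
   against the phase -2 pi xi x + 2 pi k M Psi(x); the summation is carried out through the sawtooth function,
   whose Fourier series is Abel-summed. Let X be the point with 2 pi |k| M mu(X) = 4 pi Omega. On [-X,X] the phase
   has no stationary point and m integrations by parts give O((|k| M)^(-m)). Beyond X there may be
   stationary points, but the second derivative test gives O(X^(1/2-a) Omega^(-1/2)), and alpha is chosen such
   that this is M^(-m) times a summable power of |k|. Hence the error is O(M^(-m)) uniformly for |xi| <= Omega,
   while for |xi| > Omega it is |f^(xi)| = O(|xi|^(-b)) with Omega^(-b) = M^(-m). Both cases are bounded by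
   a multiple of M^(-m) (1 + (xi/Omega)^2)^(-b/2), which has L_p norm of order M^(-m) Omega^(1/p). *)

theory Submission
  imports Defs
begin


subsection \<open>Powers of \<open>1 + x\<^sup>2\<close> and symbol classes\<close>

text \<open>The bounds are summed over k and taken uniformly in xi and M, so one constant has to
  serve all phases at once. This is why the symbol classes carry an index \<open>q\<close> for the
  phase parameters and fix their constants before \<open>q\<close>. The sampled function is f e /
  \<mu> with e the character, and only an integrable first derivative of it is used. The sawtooth
  form of Poisson summation asks for no more. Its Abel means have absolute value at most pi, so
  dominated convergence removes the regularisation, while the bounds on the terms do not depend on
  the Abel parameter. Origin of \<alpha>: X^\<alpha> has the order of |k| M / \<Omega>, so the outer
  bound is (|k| M / \<Omega>)^(-q) \<Omega>^(-1/2) with q = (a - 1/2) / \<alpha>. For \<Omega> =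
  M^(m/b) the power of M is -m exactly if q = m (2b - 1) / (2 (b - m)). The lower bound on a then
  says \<alpha> > 1, so that \<mu> has finite mass. Moreover q > m \<ge> 2 makes the sum over k
  converge and gives \<alpha> m < a - 1/2, which keeps the weight left by m integrations by parts
  integrable.\<close>

text \<open>The power \<open>s\<close> of the Japanese bracket \<open>\<langle>x\<rangle> = sqrt (1 + x\<^sup>2)\<close>.\<close>

definition jap :: "real \<Rightarrow> real \<Rightarrow> real" where
  "jap s x = (1 + x\<^sup>2) powr (s / 2)"

lemma one_plus_sq_pos [simp]: "(0::real) < 1 + x\<^sup>2"
  by (simp add: add_pos_nonneg)

lemma jap_pos [simp]: "jap s x > 0"
  by (simp add: jap_def)
    (metis less_irrefl one_plus_sq_pos)

lemma jap_nonneg [simp]: "jap s x \<ge> 0"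
  by (simp add: less_imp_le)

lemma jap_neq_0 [simp]: "jap s x \<noteq> 0"
  using jap_pos[of s x] by linarith

lemma jap_mult: "jap s x * jap t x = jap (s + t) x"
  by (simp add: jap_def powr_add[symmetric] add_divide_distrib)

lemma jap_0 [simp]: "jap 0 x = 1"
  using one_plus_sq_pos[of x] by (simp add: jap_def del: one_plus_sq_pos)

lemma jap_uminus_exponent: "jap (- s) x = 1 / jap s x"
  by (simp add: jap_def powr_minus_divide)

lemma jap_divide: "jap s x / jap t x = jap (s - t) x"
  using jap_mult[of s x "- t"] by (simp add: jap_uminus_exponent)

lemma jap_even [simp]: "jap s (- x) = jap s x"
  by (simp add: jap_def)

lemma jap_powr: "jap s x powr t = jap (s * t) x"
  by (simp add: jap_def powr_powr)

lemma jap_power: "jap s x ^ n = jap (s * real n) x"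
  using jap_powr[of s x "real n"] by (simp add: powr_realpow)

lemma jap_mono: "s \<le> t \<Longrightarrow> jap s x \<le> jap t x"
  by (simp add: jap_def powr_mono)

lemma jap_le_1: "s \<le> 0 \<Longrightarrow> jap s x \<le> 1"
  using jap_mono[of s 0 x] by simp

lemma jap_antimono_abs: "s \<le> 0 \<Longrightarrow> \<bar>x\<bar> \<le> \<bar>y\<bar> \<Longrightarrow> jap s y \<le> jap s x"
  unfolding jap_def by (rule powr_mono2') (auto simp: abs_le_square_iff)

lemma power2_powr_half: "((x::real)\<^sup>2) powr (s / 2) = \<bar>x\<bar> powr s"
proof -
  have "(x\<^sup>2) powr (s/2) = (\<bar>x\<bar> powr 2) powr (s/2)"
    by (simp add: powr_numeral del: powr_powr)
  also have "\<dots> = \<bar>x\<bar> powr s" by (simp only: powr_powr) simp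
  finally show ?thesis .
qed

lemma jap_le_powr: "s \<le> 0 \<Longrightarrow> x \<noteq> 0 \<Longrightarrow> jap s x \<le> \<bar>x\<bar> powr s"
  unfolding jap_def power2_powr_half[symmetric] by (rule powr_mono2') auto

text \<open>For |x| \<ge> 1 one has 1 + x^2 \<le> 2 x^2, and a nonpositive exponent reverses this.
  Together with \<open>jap_le_powr\<close> it allows switching between brackets and pure powers away
  from the origin.\<close>

lemma powr_le_jap:
  assumes s: "s \<le> 0" and x: "\<bar>x\<bar> \<ge> 1"
  shows "\<bar>x\<bar> powr s \<le> 2 powr (- s / 2) * jap s x"
proof -
  have "1 \<le> \<bar>x\<bar>\<^sup>2" using x by (rule one_le_power)
  hence x2: "1 \<le> x\<^sup>2" by simp
  have "(2 * x\<^sup>2) powr (s/2) \<le> jap s x"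
    unfolding jap_def by (rule powr_mono2') (use s x2 in auto)
  hence "2 powr (-s/2) * (2 powr (s/2) * \<bar>x\<bar> powr s) \<le> 2 powr (-s/2) * jap s x"
    by (intro mult_left_mono) (auto simp: powr_mult power2_powr_half)
  moreover have "2 powr (-s/2) * (2 powr (s/2) * \<bar>x\<bar> powr s) = \<bar>x\<bar> powr s"
    by (simp add: mult.assoc[symmetric] powr_add[symmetric])
  ultimately show ?thesis by linarith
qed

lemma abs_le_jap: "\<bar>x\<bar> \<le> jap 1 x"
  by (simp add: jap_def powr_half_sqrt real_le_rsqrt)

lemma has_real_derivative_jap [derivative_intros]:
  "(g has_real_derivative g') (at x) \<Longrightarrow>
    ((\<lambda>x. jap s (g x)) has_real_derivative s * g x * jap (s - 2) (g x) * g') (at x)"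
proof -
  assume g: "(g has_real_derivative g') (at x)"
  have "(jap s has_real_derivative s * y * jap (s - 2) y) (at y)" for y
    unfolding jap_def [abs_def]
    by (rule derivative_eq_intros refl | simp)+ (simp add: diff_divide_distrib)
  from DERIV_chain2[OF this g] show ?thesis .
qed

lemma continuous_on_jap [continuous_intros]:
  "continuous_on S g \<Longrightarrow> continuous_on S (\<lambda>x. jap s (g x))"
  unfolding jap_def by (intro continuous_intros ballI) (metis less_irrefl one_plus_sq_pos)+

lemma borel_measurable_jap [measurable]: "jap s \<in> borel_measurable borel"
  by (intro borel_measurable_continuous_onI continuous_intros)

text \<open>Symbol classes, uniformly in a parameter \<open>q\<close>: for \<open>l \<le> n\<close> the \<open>l\<close>-th derivative of \<open>u q\<close> is bounded on
  \<open>D q\<close> by a constant, independent of \<open>q\<close>, times \<open>W q x (1 + x\<^sup>2) powr (- l / 2)\<close>.\<close>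

primrec symb ::
  "nat \<Rightarrow> ('q \<Rightarrow> real set) \<Rightarrow> ('q \<Rightarrow> real \<Rightarrow> real) \<Rightarrow> ('q \<Rightarrow> real \<Rightarrow> complex) \<Rightarrow> bool" where
  "symb 0 D W u \<longleftrightarrow>
     (\<exists>C\<ge>0. \<forall>q. \<forall>x\<in>D q. norm (u q x) \<le> C * W q x) \<and> (\<forall>q. continuous_on (D q) (u q))"
| "symb (Suc n) D W u \<longleftrightarrow>
     (\<exists>C\<ge>0. \<forall>q. \<forall>x\<in>D q. norm (u q x) \<le> C * W q x) \<and>
     (\<exists>u'. (\<forall>q. \<forall>x\<in>D q. (u q has_vector_derivative u' q x) (at x)) \<and>
       symb n D (\<lambda>q x. W q x * jap (-1) x) u')"

section \<open>Calculus of symbol classes\<close>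

lemma symb_bound: "symb n D W u \<Longrightarrow> \<exists>C\<ge>0. \<forall>q. \<forall>x\<in>D q. norm (u q x) \<le> C * W q x"
  by (cases n) auto

lemma symb_0I:
  "C \<ge> 0 \<Longrightarrow> (\<And>q x. x \<in> D q \<Longrightarrow> norm (u q x) \<le> C * W q x) \<Longrightarrow>
    (\<And>q. continuous_on (D q) (u q)) \<Longrightarrow> symb 0 D W u"
  by auto

lemma symb_SucI:
  "C \<ge> 0 \<Longrightarrow> (\<And>q x. x \<in> D q \<Longrightarrow> norm (u q x) \<le> C * W q x) \<Longrightarrow>
    (\<And>q x. x \<in> D q \<Longrightarrow> (u q has_vector_derivative u' q x) (at x)) \<Longrightarrow>
    symb n D (\<lambda>q x. W q x * jap (-1) x) u' \<Longrightarrow> symb (Suc n) D W u"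
  unfolding symb.simps by blast

lemma symb_SucE:
  assumes "symb (Suc n) D W u"
  obtains C u' where "C \<ge> 0" "\<And>q x. x \<in> D q \<Longrightarrow> norm (u q x) \<le> C * W q x"
    "\<And>q x. x \<in> D q \<Longrightarrow> (u q has_vector_derivative u' q x) (at x)"
    "symb n D (\<lambda>q x. W q x * jap (-1) x) u'"
  using assms unfolding symb.simps by blast

lemma symb_continuous: "symb n D W u \<Longrightarrow> continuous_on (D q) (u q)"
proof (cases n)
  case (Suc k)
  moreover assume "symb n D W u"
  ultimately obtain u' where "\<forall>q. \<forall>x\<in>D q. (u q has_vector_derivative u' q x) (at x)"
    unfolding Suc symb.simps by blast
  then show ?thesis
    by (intro continuous_at_imp_continuous_on ballI) (blast intro: has_vector_derivative_continuous)
qed auto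

lemma symb_lower: "symb (Suc n) D W u \<Longrightarrow> symb n D W u"
proof (induction n arbitrary: W u)
  case 0
  then show ?case using symb_continuous[OF 0] by auto
next
  case (Suc n)
  from Suc.prems obtain u' where
    "\<forall>q. \<forall>x\<in>D q. (u q has_vector_derivative u' q x) (at x)"
    "symb (Suc n) D (\<lambda>q x. W q x * jap (-1) x) u'"
    unfolding symb.simps(2)[of "Suc n"] by blast
  with Suc.IH[OF this(2)] symb_bound[OF Suc.prems] show ?case
    unfolding symb.simps(2)[of n] by blast
qed

lemma symb_weight_mono:
  assumes "symb n D W u" and "K \<ge> 0" and "\<And>q x. x \<in> D q \<Longrightarrow> W q x \<le> K * W' q x"
  shows "symb n D W' u"
  using assms
proof (induction n arbitrary: W W' u)
  case (0 W W' u)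
  then obtain C where C: "C \<ge> 0" "\<forall>q. \<forall>x\<in>D q. norm (u q x) \<le> C * W q x" by auto
  have "norm (u q x) \<le> (C * K) * W' q x" if "x \<in> D q" for q x
    using C(2) that mult_left_mono[OF "0.prems"(3)[OF that] C(1)] by (force simp: mult.assoc)
  moreover have "C * K \<ge> 0" using C(1) \<open>K \<ge> 0\<close> by simp
  ultimately show ?case using "0.prems"(1) by auto
next
  case (Suc n W W' u)
  then obtain C where C: "C \<ge> 0" "\<forall>q. \<forall>x\<in>D q. norm (u q x) \<le> C * W q x" by auto
  have 1: "norm (u q x) \<le> (C * K) * W' q x" if "x \<in> D q" for q x
    using C(2) that mult_left_mono[OF Suc.prems(3)[OF that] C(1)] by (force simp: mult.assoc)
  have 2: "C * K \<ge> 0" using C(1) \<open>K \<ge> 0\<close> by simp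
  obtain u' where u': "\<forall>q. \<forall>x\<in>D q. (u q has_vector_derivative u' q x) (at x)"
    "symb n D (\<lambda>q x. W q x * jap (-1) x) u'" using Suc.prems by auto
  have "symb n D (\<lambda>q x. W' q x * jap (-1) x) u'"
    by (rule Suc.IH[OF u'(2) \<open>K \<ge> 0\<close>])
      (use Suc.prems(3) in \<open>auto simp: mult.assoc[symmetric] intro!: mult_right_mono\<close>)
  with 1 2 u'(1) show ?case by auto
qed

lemma symb_weight_cong:
  "symb n D W u \<Longrightarrow> (\<And>q x. x \<in> D q \<Longrightarrow> W q x = W' q x) \<Longrightarrow> symb n D W' u"
  by (rule symb_weight_mono[of n D W u 1]) auto

lemma symb_0: "(\<And>q x. x \<in> D q \<Longrightarrow> W q x \<ge> 0) \<Longrightarrow> symb n D W (\<lambda>q x. 0)"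
proof (induction n arbitrary: W)
  case 0
  then show ?case by (auto intro!: exI[of _ 0])
next
  case (Suc n)
  have "symb n D (\<lambda>q x. W q x * jap (-1) x) (\<lambda>q x. 0)"
    using Suc by auto
  then show ?case by (auto intro!: exI[of _ 0] exI[of _ "\<lambda>q x. 0"])
qed

text \<open>Derivatives vanish, so only the size counts. The constant may vary with
  \<open>q\<close>; in this way a frequency \<eta> that is dominated by the weight enters the
  derivative of the phase.\<close>

lemma symb_const:
  assumes "\<And>q x. x \<in> D q \<Longrightarrow> norm (k q) \<le> W q x"
  shows "symb n D W (\<lambda>q x. k q)"
proof -
  have W: "W q x \<ge> 0" if "x \<in> D q" for q x
    using assms[OF that] norm_ge_zero order_trans by blast
  show ?thesis
    using assms symb_0[of D "\<lambda>q x. W q x * jap (-1) x"] W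
    by (cases n) (auto intro!: exI[of _ 1] exI[of _ "\<lambda>q x. 0"])
qed

lemma symb_add:
  "symb n D W u \<Longrightarrow> symb n D W v \<Longrightarrow> symb n D W (\<lambda>q x. u q x + v q x)"
proof (induction n arbitrary: W u v)
  case (0 W u v)
  then obtain B C where "B \<ge> 0" "\<forall>q. \<forall>x\<in>D q. norm (u q x) \<le> B * W q x"
    "C \<ge> 0" "\<forall>q. \<forall>x\<in>D q. norm (v q x) \<le> C * W q x" by auto
  hence "B + C \<ge> 0" "\<forall>q. \<forall>x\<in>D q. norm (u q x + v q x) \<le> (B + C) * W q x"
    by (auto simp: distrib_right intro!: norm_triangle_mono)
  then show ?case using 0 by (auto intro!: continuous_on_add)
next
  case (Suc n W u v)
  then obtain B C where "B \<ge> 0" "\<forall>q. \<forall>x\<in>D q. norm (u q x) \<le> B * W q x"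
    "C \<ge> 0" "\<forall>q. \<forall>x\<in>D q. norm (v q x) \<le> C * W q x" by auto
  hence 1: "B + C \<ge> 0" "\<forall>q. \<forall>x\<in>D q. norm (u q x + v q x) \<le> (B + C) * W q x"
    by (auto simp: distrib_right intro!: norm_triangle_mono)
  obtain u' v' where d: "\<forall>q. \<forall>x\<in>D q. (u q has_vector_derivative u' q x) (at x)"
    "symb n D (\<lambda>q x. W q x * jap (-1) x) u'"
    "\<forall>q. \<forall>x\<in>D q. (v q has_vector_derivative v' q x) (at x)"
    "symb n D (\<lambda>q x. W q x * jap (-1) x) v'" using Suc.prems by auto
  show ?case unfolding symb.simps
    by (intro conjI exI[of _ "B + C"] 1 exI[of _ "\<lambda>q x. u' q x + v' q x"] Suc.IH d allI ballI
        has_vector_derivative_add d[rule_format])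
qed

text \<open>Leibniz rule: each summand of the derivative pairs a differentiated factor with the
  other factor lowered by one order, and both summands carry the same extra weight
  \<open>jap (-1)\<close>.\<close>

lemma symb_mult:
  "symb n D W u \<Longrightarrow> symb n D V v \<Longrightarrow> symb n D (\<lambda>q x. W q x * V q x) (\<lambda>q x. u q x * v q x)"
proof (induction n arbitrary: W u V v)
  case (0 W u V v)
  then obtain B C where BC: "B \<ge> 0" "\<forall>q. \<forall>x\<in>D q. norm (u q x) \<le> B * W q x"
    "C \<ge> 0" "\<forall>q. \<forall>x\<in>D q. norm (v q x) \<le> C * V q x" by auto
  have "norm (u q x * v q x) \<le> (B * C) * (W q x * V q x)" if "x \<in> D q" for q x
  proof -
    have "norm (u q x) \<le> B * W q x" "norm (v q x) \<le> C * V q x" using BC that by auto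
    hence "norm (u q x) * norm (v q x) \<le> (B * W q x) * (C * V q x)"
      by (intro mult_mono) (auto intro: order_trans[OF norm_ge_zero])
    then show ?thesis by (simp add: norm_mult algebra_simps)
  qed
  moreover have "B * C \<ge> 0" using BC by simp
  ultimately show ?case using 0 by (auto intro!: continuous_on_mult)
next
  case (Suc n W u V v)
  then obtain B C where BC: "B \<ge> 0" "\<forall>q. \<forall>x\<in>D q. norm (u q x) \<le> B * W q x"
    "C \<ge> 0" "\<forall>q. \<forall>x\<in>D q. norm (v q x) \<le> C * V q x" by auto
  have 1: "norm (u q x * v q x) \<le> (B * C) * (W q x * V q x)" if "x \<in> D q" for q x
  proof -
    have "norm (u q x) \<le> B * W q x" "norm (v q x) \<le> C * V q x" using BC that by auto
    hence "norm (u q x) * norm (v q x) \<le> (B * W q x) * (C * V q x)"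
      by (intro mult_mono) (auto intro: order_trans[OF norm_ge_zero])
    then show ?thesis by (simp add: norm_mult algebra_simps)
  qed
  have 2: "B * C \<ge> 0" using BC by simp
  obtain u' v' where d: "\<forall>q. \<forall>x\<in>D q. (u q has_vector_derivative u' q x) (at x)"
    "symb n D (\<lambda>q x. W q x * jap (-1) x) u'"
    "\<forall>q. \<forall>x\<in>D q. (v q has_vector_derivative v' q x) (at x)"
    "symb n D (\<lambda>q x. V q x * jap (-1) x) v'" using Suc.prems by auto
  have "symb n D (\<lambda>q x. W q x * V q x * jap (-1) x) (\<lambda>q x. u q x * v' q x)"
    using Suc.IH[OF symb_lower[OF Suc.prems(1)] d(4)] by (simp add: mult.assoc)
  moreover have "symb n D (\<lambda>q x. W q x * V q x * jap (-1) x) (\<lambda>q x. u' q x * v q x)"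
    using Suc.IH[OF d(2) symb_lower[OF Suc.prems(2)]] by (simp add: mult.assoc mult.commute mult.left_commute)
  ultimately have "symb n D (\<lambda>q x. W q x * V q x * jap (-1) x) (\<lambda>q x. u q x * v' q x + u' q x * v q x)"
    by (rule symb_add)
  with 1 2 d(1,3) show ?case unfolding symb.simps
    by (intro conjI exI[of _ "B * C"] exI[of _ "\<lambda>q x. u q x * v' q x + u' q x * v q x"]
        has_vector_derivative_mult allI ballI) auto
qed

text \<open>The derivative of 1/u is -u' (1/u)^2, and 1/u is a symbol of the lower order by
  induction. The weights combine to \<open>jap (-1) / W\<close>. The bound from below by
  \<open>c * W\<close> is an ellipticity condition.\<close>

lemma symb_inverse:
  assumes "symb n D W u" and "c > 0"
    and "\<And>q x. x \<in> D q \<Longrightarrow> W q x > 0" and "\<And>q x. x \<in> D q \<Longrightarrow> c * W q x \<le> norm (u q x)"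
  shows "symb n D (\<lambda>q x. 1 / W q x) (\<lambda>q x. 1 / u q x)"
  using assms(1)
proof (induction n)
  have nz: "u q x \<noteq> 0" if "x \<in> D q" for q x
    using assms(2-4) that by (metis mult_pos_pos norm_zero not_less)
  have b: "norm (1 / u q x) \<le> (1 / c) * (1 / W q x)" if "x \<in> D q" for q x
    using assms(2-4) that nz[OF that] by (simp add: norm_divide frac_le)
  have c: "1 / c \<ge> 0" using assms(2) by simp
  {
    case 0
    then show ?case using nz
      by (intro symb_0I[OF c b]) (auto intro!: continuous_on_divide)
  next
    case (Suc n)
    then obtain u' where d: "\<forall>q. \<forall>x\<in>D q. (u q has_vector_derivative u' q x) (at x)"
      "symb n D (\<lambda>q x. W q x * jap (-1) x) u'" by auto
    note I = Suc.IH[OF symb_lower[OF Suc.prems]]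
    have "symb n D (\<lambda>q x. 1 * ((W q x * jap (-1) x) * ((1 / W q x) * (1 / W q x))))
        (\<lambda>q x. (-1) * (u' q x * ((1 / u q x) * (1 / u q x))))"
      by (intro symb_mult I d symb_const) auto
    hence 2: "symb n D (\<lambda>q x. 1 / W q x * jap (-1) x) (\<lambda>q x. (-1) * (u' q x * ((1 / u q x) * (1 / u q x))))"
      by (rule symb_weight_cong) (use assms(3) in \<open>auto simp: field_simps less_imp_neq[symmetric]\<close>)
    have "((\<lambda>x. 1 / u q x) has_vector_derivative (-1) * (u' q x * ((1 / u q x) * (1 / u q x)))) (at x)"
      if "x \<in> D q" for q x
    proof -
      have "(u q has_vector_derivative u' q x) (at x)" using d that by auto
      from field_vector_diff_chain_at[OF this, of inverse "- (inverse (u q x) * inverse (u q x))"]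
      have "(inverse \<circ> u q has_vector_derivative u' q x * - (inverse (u q x) * inverse (u q x))) (at x)"
        using DERIV_inverse'[OF DERIV_ident nz[OF that]] by simp
      then show ?thesis by (simp add: o_def field_simps)
    qed
    from symb_SucI[OF c b this 2] show ?case .
  }
qed

text \<open>The derivative is s x \<open>jap (s - 2) x\<close>, a product of the symbol x of weight
  \<open>jap 1\<close> and a bracket with another exponent; hence the induction has to leave
  \<open>s\<close> arbitrary.\<close>

lemma symb_jap: "symb n D (\<lambda>q x. jap s x) (\<lambda>q x. complex_of_real (jap s x))"
proof (induction n arbitrary: s)
  case 0
  show ?case by (rule symb_0I[of 1]) (auto intro!: continuous_intros)
next
  case (Suc n)
  have le: "norm (complex_of_real x) \<le> 1 * jap 1 x" for x
    using abs_le_jap by simp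
  have x: "symb k D (\<lambda>q x. jap 1 x) (\<lambda>q x. complex_of_real x)" for k
  proof (cases k)
    case 0
    show ?thesis unfolding 0
      by (rule symb_0I[of 1]) (use le in \<open>auto intro!: continuous_intros\<close>)
  next
    case (Suc k)
    have "symb k D (\<lambda>q x. jap 1 x * jap (-1) x) (\<lambda>q x. 1)"
      by (rule symb_const) (simp add: jap_mult)
    moreover have "(complex_of_real has_vector_derivative 1) (at x)" for x
      using has_vector_derivative_of_real[OF DERIV_ident, of "at x"] by simp
    ultimately show ?thesis unfolding Suc
      by (intro symb_SucI[where C = 1 and u' = "\<lambda>q x. 1"] le) auto
  qed
  have "symb n D (\<lambda>q x. \<bar>s\<bar> * (jap 1 x * jap (s-2) x)) (\<lambda>q x. of_real s * (of_real x * of_real (jap (s - 2) x)))"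
    by (intro symb_mult symb_const Suc x) auto
  hence *: "symb n D (\<lambda>q x. jap s x * jap (-1) x) (\<lambda>q x. of_real (s * x * jap (s - 2) x))"
    by (subst of_real_mult, subst of_real_mult, subst mult.assoc, rule symb_weight_mono[where K = "\<bar>s\<bar>"])
      (auto simp: jap_mult)
  have "((\<lambda>x. complex_of_real (jap s x)) has_vector_derivative of_real (s * x * jap (s - 2) x)) (at x)" for x
    using has_real_derivative_jap[OF DERIV_ident, of s x]
    by (intro has_vector_derivative_of_real) auto
  from symb_SucI[OF _ _ this *, of 1] show ?case by auto
qed

section \<open>Repeated integration by parts for a phase without stationary points\<close>

lemma has_vector_derivative_cis:
  assumes "(\<phi> has_real_derivative \<phi>') (at x within S)"
  shows "((\<lambda>x. cis (\<phi> x)) has_vector_derivative \<i> * of_real \<phi>' * cis (\<phi> x)) (at x within S)"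
proof -
  have "(\<phi> has_derivative (\<lambda>t. \<phi>' * t)) (at x within S)"
    using assms by (simp add: has_field_derivative_def)
  from has_derivative_cis[OF this] show ?thesis
    by (simp add: has_vector_derivative_def scaleR_conv_of_real mult_ac)
qed

text \<open>One integration by parts replaces h by the derivative of h / (i \<phi>'), which is a
  symbol of weight \<open>W * jap (-1) / P\<close> because \<phi>' is elliptic of weight
  \<open>P\<close> on \<open>D q\<close>. After n rounds the weight has gained
  \<open>(jap (-1) / P) ^ n\<close>. Only the boundary terms of the first round are recorded, since
  they dominate the later ones.\<close>

lemma integral_cis_by_parts_bound:
  assumes "\<And>q x. x \<in> D q \<Longrightarrow> (\<phi> q has_real_derivative \<phi>' q x) (at x)"
    and "symb n D P (\<lambda>q x. complex_of_real (\<phi>' q x))"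
    and "c > 0" and "\<And>q x. x \<in> D q \<Longrightarrow> c * P q x \<le> \<bar>\<phi>' q x\<bar>"
    and "\<And>q x. x \<in> D q \<Longrightarrow> P q x \<ge> 1"
    and "\<And>q. continuous_on (D q) (P q)"
    and "symb n D W h" and "\<And>q x. x \<in> D q \<Longrightarrow> W q x \<ge> 0" and "\<And>q. continuous_on (D q) (W q)"
  shows "\<exists>C\<ge>0. \<forall>q u v. u \<le> v \<longrightarrow> {u..v} \<subseteq> D q \<longrightarrow>
    norm (integral {u..v} (\<lambda>x. h q x * cis (\<phi> q x))) \<le>
      C * (integral {u..v} (\<lambda>x. W q x * (jap (-1) x / P q x) ^ n) + W q u / P q u + W q v / P q v)"
  using assms(2,7-9)
proof (induction n arbitrary: h W)
  have cis_cont: "continuous_on (D q) (\<lambda>x. cis (\<phi> q x))" for q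
    using assms(1) by (intro continuous_intros) (meson DERIV_continuous continuous_at_imp_continuous_on)
  {
    case (0 h W)
    then obtain C where C: "C \<ge> 0" "\<And>q x. x \<in> D q \<Longrightarrow> norm (h q x) \<le> C * W q x"
      and hc: "\<And>q. continuous_on (D q) (h q)" by auto
    have "norm (integral {u..v} (\<lambda>x. h q x * cis (\<phi> q x))) \<le>
        C * (integral {u..v} (\<lambda>x. W q x * (jap (-1) x / P q x) ^ 0) + W q u / P q u + W q v / P q v)"
      if uv: "u \<le> v" "{u..v} \<subseteq> D q" for q u v
    proof -
      have "norm (integral {u..v} (\<lambda>x. h q x * cis (\<phi> q x))) \<le> integral {u..v} (\<lambda>x. C * W q x)"
        by (intro integral_norm_bound_integral integrable_continuous_interval
            continuous_on_mult continuous_on_const)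
          (use C(2) uv hc[of q] cis_cont[of q] 0(4)[of q]
            in \<open>auto simp: norm_mult intro: continuous_on_subset\<close>)
      also have "\<dots> = C * integral {u..v} (\<lambda>x. W q x * (jap (-1) x / P q x) ^ 0)" by simp
      also have "\<dots> \<le> C * (integral {u..v} (\<lambda>x. W q x * (jap (-1) x / P q x) ^ 0) + W q u / P q u + W q v / P q v)"
      proof -
        have "u \<in> D q" "v \<in> D q" using uv by auto
        then have "W q u / P q u \<ge> 0" "W q v / P q v \<ge> 0"
          using 0(3) assms(5) by (force intro!: divide_nonneg_nonneg intro: order_trans[OF zero_le_one])+
        then show ?thesis using C(1) by (intro mult_left_mono) auto
      qed
      finally show ?thesis .
    qed
    with C(1) show ?case by blast
  next
    case (Suc n h W)
    have P0: "P q x > 0" if "x \<in> D q" for q x using assms(5)[OF that] by simp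
    have nz: "\<phi>' q x \<noteq> 0" if "x \<in> D q" for q x
      using assms(4)[OF that] mult_pos_pos[OF \<open>c > 0\<close> P0[OF that]] by auto
    \<comment> \<open>This is h / (i \<phi>'), so that the derivative of k cis \<phi> is k' cis
      \<phi> plus the original integrand.\<close>
    define k where "k = (\<lambda>q x. h q x * (- \<i> * (1 / complex_of_real (\<phi>' q x))))"
    have "symb (Suc n) D (\<lambda>q x. W q x * (1 * (1 / P q x))) k"
      unfolding k_def
      by (intro symb_mult Suc.prems symb_const symb_inverse[OF Suc.prems(1) \<open>c > 0\<close>])
        (use P0 assms(4) in auto)
    hence k: "symb (Suc n) D (\<lambda>q x. W q x / P q x) k" by simp
    then obtain C1 k' where C1: "C1 \<ge> 0" "\<And>q x. x \<in> D q \<Longrightarrow> norm (k q x) \<le> C1 * (W q x / P q x)"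
      and k': "\<And>q x. x \<in> D q \<Longrightarrow> (k q has_vector_derivative k' q x) (at x)"
      and sk': "symb n D (\<lambda>q x. W q x / P q x * jap (-1) x) k'"
      by (rule symb_SucE) blast
    have "\<exists>C\<ge>0. \<forall>q u v. u \<le> v \<longrightarrow> {u..v} \<subseteq> D q \<longrightarrow>
      norm (integral {u..v} (\<lambda>x. k' q x * cis (\<phi> q x))) \<le>
        C * (integral {u..v} (\<lambda>x. W q x / P q x * jap (-1) x * (jap (-1) x / P q x) ^ n)
          + W q u / P q u * jap (-1) u / P q u + W q v / P q v * jap (-1) v / P q v)"
      by (rule Suc.IH[OF symb_lower[OF Suc.prems(1)] sk'])
        (use Suc.prems(3,4) P0 assms(6) in
          \<open>auto intro!: mult_nonneg_nonneg divide_nonneg_pos continuous_intros less_imp_neq[symmetric]\<close>)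
    then obtain C2 where C2: "C2 \<ge> 0" "\<And>q u v. u \<le> v \<Longrightarrow> {u..v} \<subseteq> D q \<Longrightarrow>
      norm (integral {u..v} (\<lambda>x. k' q x * cis (\<phi> q x))) \<le>
        C2 * (integral {u..v} (\<lambda>x. W q x / P q x * jap (-1) x * (jap (-1) x / P q x) ^ n)
          + W q u / P q u * jap (-1) u / P q u + W q v / P q v * jap (-1) v / P q v)"
      by blast
    have "norm (integral {u..v} (\<lambda>x. h q x * cis (\<phi> q x))) \<le>
        (C1 + C2) * (integral {u..v} (\<lambda>x. W q x * (jap (-1) x / P q x) ^ Suc n) + W q u / P q u + W q v / P q v)"
      if uv: "u \<le> v" "{u..v} \<subseteq> D q" for q u v
    proof -
      have D: "x \<in> D q" if "u \<le> x" "x \<le> v" for x using uv that by auto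
      define J where "J = integral {u..v} (\<lambda>x. W q x * (jap (-1) x / P q x) ^ Suc n)"
      have end_nonneg: "W q x / P q x \<ge> 0" if "x \<in> D q" for x
        using Suc.prems(3)[OF that] P0[OF that] by simp
      \<comment> \<open>Boundary terms of later rounds carry extra factors
        \<open>jap (-1) / P\<close>, which are at most 1 because \<open>P\<close> is at least
        1.\<close>
      have end_le: "W q x / P q x * jap (-1) x / P q x \<le> W q x / P q x" if "x \<in> D q" for x
      proof -
        have "jap (-1) x / P q x \<le> 1"
          using assms(5)[OF that] jap_le_1[of "-1" x] by simp
        from mult_left_mono[OF this end_nonneg[OF that]] show ?thesis by simp
      qed
      have cWP: "continuous_on {u..v} (W q)" "continuous_on {u..v} (P q)"
        using continuous_on_subset uv(2) Suc.prems(4) assms(6) by blast+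
      have J0: "J \<ge> 0" unfolding J_def
        by (intro integral_nonneg integrable_continuous_interval continuous_intros
            mult_nonneg_nonneg zero_le_power divide_nonneg_pos)
          (use D Suc.prems(3) P0 cWP in \<open>force+\<close>)
      have d: "((\<lambda>x. k q x * cis (\<phi> q x)) has_vector_derivative
          (k' q x * cis (\<phi> q x) + h q x * cis (\<phi> q x))) (at x within {u..v})" if "x \<in> {u..v}" for x
      proof -
        have x: "x \<in> D q" using that D by auto
        have "((\<lambda>x. cis (\<phi> q x)) has_vector_derivative (\<i> * of_real (\<phi>' q x) * cis (\<phi> q x))) (at x)"
          by (rule has_vector_derivative_cis[OF assms(1)[OF x]])
        from has_vector_derivative_mult[OF k'[OF x] this]
        have "((\<lambda>x. k q x * cis (\<phi> q x)) has_vector_derivative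
            (k q x * (\<i> * of_real (\<phi>' q x) * cis (\<phi> q x)) + k' q x * cis (\<phi> q x))) (at x)" .
        moreover have "k q x * (\<i> * of_real (\<phi>' q x) * cis (\<phi> q x)) = h q x * cis (\<phi> q x)"
          using nz[OF x] by (simp add: k_def)
        ultimately show ?thesis
          by (simp add: add.commute has_vector_derivative_at_within)
      qed
      have i1: "(\<lambda>x. k' q x * cis (\<phi> q x)) integrable_on {u..v}"
        "(\<lambda>x. h q x * cis (\<phi> q x)) integrable_on {u..v}"
        using symb_continuous[OF sk', of q] symb_continuous[OF Suc.prems(2), of q] cis_cont[of q] uv
        by (auto intro!: integrable_continuous_interval continuous_on_mult intro: continuous_on_subset)
      have "integral {u..v} (\<lambda>x. k' q x * cis (\<phi> q x)) + integral {u..v} (\<lambda>x. h q x * cis (\<phi> q x))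
          = k q v * cis (\<phi> q v) - k q u * cis (\<phi> q u)"
        using integral_add[OF i1] fundamental_theorem_of_calculus[OF uv(1) d]
        by (simp add: integral_unique)
      hence eq: "integral {u..v} (\<lambda>x. h q x * cis (\<phi> q x)) =
          k q v * cis (\<phi> q v) - k q u * cis (\<phi> q u) - integral {u..v} (\<lambda>x. k' q x * cis (\<phi> q x))"
        by (simp add: algebra_simps)
      have "norm (integral {u..v} (\<lambda>x. h q x * cis (\<phi> q x))) \<le>
          norm (k q v) + norm (k q u) + norm (integral {u..v} (\<lambda>x. k' q x * cis (\<phi> q x)))"
        unfolding eq
        by (rule order_trans[OF norm_triangle_ineq4], rule add_right_mono,
            rule order_trans[OF norm_triangle_ineq4]) (simp add: norm_mult)
      also have "\<dots> \<le> C1 * (W q v / P q v) + C1 * (W q u / P q u) + C2 * (J + W q u / P q u + W q v / P q v)"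
      proof (intro add_mono C1 D)
        have "norm (integral {u..v} (\<lambda>x. k' q x * cis (\<phi> q x))) \<le>
          C2 * (J + W q u / P q u * jap (-1) u / P q u + W q v / P q v * jap (-1) v / P q v)"
          using C2(2)[OF uv] by (simp add: J_def power_divide mult_ac)
        also have "\<dots> \<le> C2 * (J + W q u / P q u + W q v / P q v)"
          by (intro mult_left_mono add_mono C2 end_le D) (use uv in auto)
        finally show "norm (integral {u..v} (\<lambda>x. k' q x * cis (\<phi> q x))) \<le>
          C2 * (J + W q u / P q u + W q v / P q v)" .
      qed (use uv in auto)
      also have "\<dots> \<le> (C1 + C2) * (J + W q u / P q u + W q v / P q v)"
        using mult_nonneg_nonneg[OF C1(1) J0] by (simp only: distrib_left distrib_right)
      finally show ?thesis unfolding J_def .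
    qed
    with C1(1) C2(1) show ?case by (intro exI[of _ "C1 + C2"]) auto
  }
qed


subsection \<open>Van der Corput estimates\<close>

lemma real_deriv_continuous_on:
  fixes f :: "real \<Rightarrow> real"
  assumes "\<And>x. x \<in> S \<Longrightarrow> (f has_real_derivative f' x) (at x)"
  shows "continuous_on S f"
  using assms by (meson DERIV_continuous continuous_at_imp_continuous_on)

text \<open>Integrate by parts after dividing by \<phi>'. Since \<phi>' is monotone, the variation
  of 1/\<phi>' telescopes to 1/\<phi>'(u) - 1/\<phi>'(v), which together with the boundary terms
  1/\<phi>'(u) + 1/\<phi>'(v) gives 2/\<phi>'(u).\<close>

lemma integral_cis_first_derivative:
  fixes \<phi> \<phi>' \<phi>'' :: "real \<Rightarrow> real"
  assumes "u \<le> v" and "\<delta> > 0"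
    and d1: "\<And>x. x \<in> {u..v} \<Longrightarrow> (\<phi> has_real_derivative \<phi>' x) (at x)"
    and d2: "\<And>x. x \<in> {u..v} \<Longrightarrow> (\<phi>' has_real_derivative \<phi>'' x) (at x)"
    and c: "continuous_on {u..v} \<phi>''" and n: "\<And>x. x \<in> {u..v} \<Longrightarrow> \<phi>'' x \<ge> 0"
    and lb: "\<And>x. x \<in> {u..v} \<Longrightarrow> \<phi>' x \<ge> \<delta>"
  shows "norm (integral {u..v} (\<lambda>x. cis (\<phi> x))) \<le> 2 / \<delta>"
proof -
  have pos: "\<phi>' x > 0" if "x \<in> {u..v}" for x using lb[OF that] \<open>\<delta> > 0\<close> by linarith
  have cont: "continuous_on {u..v} \<phi>" "continuous_on {u..v} \<phi>'"
    using real_deriv_continuous_on[of "{u..v}"] d1 d2 by auto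
  define g where "g = (\<lambda>x. cis (\<phi> x) * of_real (1 / \<phi>' x))"
  define r where "r = (\<lambda>x. cis (\<phi> x) * of_real (\<phi>'' x / (\<phi>' x)\<^sup>2))"
  have dinv: "((\<lambda>x. 1 / \<phi>' x) has_real_derivative - (\<phi>'' x / (\<phi>' x)\<^sup>2)) (at x)" if "x \<in> {u..v}" for x
    using pos[OF that] by (auto intro!: derivative_eq_intros d2[OF that] simp: power2_eq_square)
  have dg: "(g has_vector_derivative \<i> * cis (\<phi> x) - r x) (at x within {u..v})" if "x \<in> {u..v}" for x
  proof -
    have "(g has_vector_derivative cis (\<phi> x) * of_real (- (\<phi>'' x / (\<phi>' x)\<^sup>2))
        + \<i> * of_real (\<phi>' x) * cis (\<phi> x) * of_real (1 / \<phi>' x)) (at x)"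
      unfolding g_def
      by (intro has_vector_derivative_mult has_vector_derivative_cis has_vector_derivative_of_real
          d1 dinv that)
    then show ?thesis
      using pos[OF that] by (simp add: r_def has_vector_derivative_at_within)
  qed
  have i: "(\<lambda>x. \<i> * cis (\<phi> x)) integrable_on {u..v}" "r integrable_on {u..v}"
    unfolding r_def using pos cont c
    by (force intro!: integrable_continuous_interval continuous_intros)+
  have "norm (integral {u..v} r) \<le> integral {u..v} (\<lambda>x. \<phi>'' x / (\<phi>' x)\<^sup>2)"
    using i(2) pos cont c n
    by (intro integral_norm_bound_integral)
      (force simp: r_def norm_mult norm_divide norm_power intro!: integrable_continuous_interval continuous_intros)+
  also have "\<dots> = 1 / \<phi>' u - 1 / \<phi>' v"
  proof -
    have "((\<lambda>x. - (\<phi>'' x / (\<phi>' x)\<^sup>2)) has_integral 1 / \<phi>' v - 1 / \<phi>' u) {u..v}"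
      using dinv by (intro fundamental_theorem_of_calculus \<open>u \<le> v\<close>)
        (metis has_field_derivative_at_within has_real_derivative_iff_has_vector_derivative)
    from has_integral_neg[OF this] show ?thesis by (simp add: integral_unique)
  qed
  finally have ir: "norm (integral {u..v} r) \<le> 1 / \<phi>' u - 1 / \<phi>' v" .
  have "integral {u..v} (\<lambda>x. \<i> * cis (\<phi> x)) - integral {u..v} r = g v - g u"
    using integral_diff[OF i] fundamental_theorem_of_calculus[OF \<open>u \<le> v\<close> dg]
    by (simp add: integral_unique)
  hence "\<i> * integral {u..v} (\<lambda>x. cis (\<phi> x)) = g v - g u + integral {u..v} r"
    by (simp add: algebra_simps)
  hence "norm (integral {u..v} (\<lambda>x. cis (\<phi> x))) = norm (g v - g u + integral {u..v} r)"
    by (metis norm_mult norm_ii mult_1)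
  also have "\<dots> \<le> norm (g v) + norm (g u) + norm (integral {u..v} r)"
    by (meson add_mono norm_triangle_ineq norm_triangle_ineq4 order_refl order_trans)
  also have "norm (g v) = 1 / \<phi>' v"
    using pos[of v] \<open>u \<le> v\<close> by (auto simp: g_def norm_mult norm_divide)
  also have "norm (g u) = 1 / \<phi>' u"
    using pos[of u] \<open>u \<le> v\<close> by (auto simp: g_def norm_mult norm_divide)
  finally have "norm (integral {u..v} (\<lambda>x. cis (\<phi> x))) \<le> 2 * (1 / \<phi>' u)" using ir by simp
  also have "\<dots> \<le> 2 * (1 / \<delta>)"
    using lb[of u] \<open>u \<le> v\<close> \<open>\<delta> > 0\<close> by (intro mult_left_mono divide_left_mono) (auto intro: pos)
  finally show ?thesis by simp
qed

text \<open>Cut at distance \<epsilon> = 1 / sqrt \<rho> from u. The short piece is bounded by its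
  length \<epsilon>. Beyond it \<phi>' has grown to at least \<rho> \<epsilon> = sqrt \<rho>, and
  the first derivative test gives 2 / sqrt \<rho>. This \<epsilon> balances the two bounds.\<close>

lemma integral_cis_second_derivative_right:
  fixes \<phi> \<phi>' \<phi>'' :: "real \<Rightarrow> real"
  assumes "u \<le> v" and "\<rho> > 0"
    and d1: "\<And>x. x \<in> {u..v} \<Longrightarrow> (\<phi> has_real_derivative \<phi>' x) (at x)"
    and d2: "\<And>x. x \<in> {u..v} \<Longrightarrow> (\<phi>' has_real_derivative \<phi>'' x) (at x)"
    and c: "continuous_on {u..v} \<phi>''" and lb: "\<And>x. x \<in> {u..v} \<Longrightarrow> \<phi>'' x \<ge> \<rho>"
    and "\<phi>' u \<ge> 0"
  shows "norm (integral {u..v} (\<lambda>x. cis (\<phi> x))) \<le> 3 / sqrt \<rho>"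
proof -
  have cont: "continuous_on {u..v} \<phi>"
    using real_deriv_continuous_on[of "{u..v}"] d1 by auto
  have i: "(\<lambda>x. cis (\<phi> x)) integrable_on {s..t}" if "{s..t} \<subseteq> {u..v}" for s t
    by (intro integrable_continuous_interval continuous_on_cis continuous_on_subset[OF cont that])
  have triv: "norm (integral {u..t} (\<lambda>x. cis (\<phi> x))) \<le> t - u" if "u \<le> t" "t \<le> v" for t
  proof -
    have "norm (integral {u..t} (\<lambda>x. cis (\<phi> x))) \<le> integral {u..t} (\<lambda>x. 1)"
      by (intro integral_norm_bound_integral i) (use that in auto)
    then show ?thesis using that by simp
  qed
  define \<epsilon> where "\<epsilon> = 1 / sqrt \<rho>"
  have e: "\<epsilon> > 0" "\<rho> * \<epsilon> = sqrt \<rho>"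
    using \<open>\<rho> > 0\<close> real_sqrt_mult_self[of \<rho>] by (auto simp: \<epsilon>_def field_simps)
  show ?thesis
  proof (cases "v - u \<le> \<epsilon>")
    case True
    have "norm (integral {u..v} (\<lambda>x. cis (\<phi> x))) \<le> \<epsilon>"
      using triv[of v] True \<open>u \<le> v\<close> by simp
    also have "\<dots> \<le> 3 / sqrt \<rho>" using \<open>\<rho> > 0\<close> by (simp add: \<epsilon>_def divide_right_mono)
    finally show ?thesis .
  next
    case False
    have grow: "\<phi>' x \<ge> \<rho> * \<epsilon>" if x: "x \<in> {u+\<epsilon>..v}" for x
    proof -
      have "\<phi>' x - \<rho> * x \<ge> \<phi>' u - \<rho> * u"
      proof (rule DERIV_nonneg_imp_nondecreasing[of u x "\<lambda>x. \<phi>' x - \<rho> * x"])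
        fix y assume "u \<le> y" "y \<le> x"
        hence y: "y \<in> {u..v}" using x by auto
        show "\<exists>d. ((\<lambda>x. \<phi>' x - \<rho> * x) has_real_derivative d) (at y) \<and> 0 \<le> d"
          by (rule exI[of _ "\<phi>'' y - \<rho>"]) (use lb[OF y] in \<open>auto intro!: derivative_eq_intros d2[OF y]\<close>)
      qed (use x e in auto)
      moreover have "\<rho> * (x - u) \<ge> \<rho> * \<epsilon>" using x \<open>\<rho> > 0\<close> by auto
      ultimately show ?thesis using \<open>\<phi>' u \<ge> 0\<close> by (simp add: algebra_simps)
    qed
    have "norm (integral {u+\<epsilon>..v} (\<lambda>x. cis (\<phi> x))) \<le> 2 / sqrt \<rho>"
      by (rule integral_cis_first_derivative[where \<phi>' = \<phi>' and \<phi>'' = \<phi>''])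
        (use False e d1 d2 lb grow \<open>\<rho> > 0\<close> in \<open>auto intro: continuous_on_subset[OF c] order_trans[OF less_imp_le[OF \<open>\<rho> > 0\<close>]]\<close>)
    moreover have "norm (integral {u..u+\<epsilon>} (\<lambda>x. cis (\<phi> x))) \<le> 1 / sqrt \<rho>"
      using triv[of "u + \<epsilon>"] False e by (auto simp: \<epsilon>_def)
    moreover have "integral {u..v} (\<lambda>x. cis (\<phi> x)) =
        integral {u..u+\<epsilon>} (\<lambda>x. cis (\<phi> x)) + integral {u+\<epsilon>..v} (\<lambda>x. cis (\<phi> x))"
      by (rule Henstock_Kurzweil_Integration.integral_combine[symmetric])
        (use False e i[of u v] in auto)
    ultimately have "norm (integral {u..v} (\<lambda>x. cis (\<phi> x))) \<le> 1 / sqrt \<rho> + 2 / sqrt \<rho>"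
      by (simp only: norm_triangle_mono)
    then show ?thesis by (simp add: add_divide_distrib[symmetric])
  qed
qed

text \<open>Reflection x -> -x keeps the second derivative and negates the first, so the endpoint v
  with nonpositive \<phi>' becomes a left endpoint with nonnegative one.\<close>

lemma integral_cis_second_derivative_left:
  fixes \<phi> \<phi>' \<phi>'' :: "real \<Rightarrow> real"
  assumes "u \<le> v" and "\<rho> > 0"
    and d1: "\<And>x. x \<in> {u..v} \<Longrightarrow> (\<phi> has_real_derivative \<phi>' x) (at x)"
    and d2: "\<And>x. x \<in> {u..v} \<Longrightarrow> (\<phi>' has_real_derivative \<phi>'' x) (at x)"
    and c: "continuous_on {u..v} \<phi>''" and lb: "\<And>x. x \<in> {u..v} \<Longrightarrow> \<phi>'' x \<ge> \<rho>"
    and "\<phi>' v \<le> 0"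
  shows "norm (integral {u..v} (\<lambda>x. cis (\<phi> x))) \<le> 3 / sqrt \<rho>"
proof -
  have "norm (integral {-v..-u} (\<lambda>x. cis (\<phi> (- x)))) \<le> 3 / sqrt \<rho>"
  proof (rule integral_cis_second_derivative_right[where \<phi>' = "\<lambda>x. - \<phi>' (- x)" and \<phi>'' = "\<lambda>x. \<phi>'' (- x)"])
    fix x assume x: "x \<in> {-v..-u}"
    hence "- x \<in> {u..v}" by auto
    note D = d1[OF this] d2[OF this]
    show "((\<lambda>x. \<phi> (- x)) has_real_derivative - \<phi>' (- x)) (at x)"
      using D(1) by (simp add: DERIV_mirror)
    show "((\<lambda>x. - \<phi>' (- x)) has_real_derivative \<phi>'' (- x)) (at x)"
      using DERIV_minus[OF D(2)[unfolded DERIV_mirror]] by simp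
  next
    show "continuous_on {- v..- u} (\<lambda>x. \<phi>'' (- x))"
      by (rule continuous_on_compose2[OF c]) (auto intro!: continuous_intros)
  qed (use assms in auto)
  then show ?thesis by (simp only: Henstock_Kurzweil_Integration.integral_reflect_real[where f = "\<lambda>x. cis (\<phi> x)"])
qed

text \<open>As \<phi>' is increasing, it either keeps one sign, or the interval splits at a zero of
  \<phi>' into one piece for each one-sided estimate.\<close>

lemma integral_cis_second_derivative:
  fixes \<phi> \<phi>' \<phi>'' :: "real \<Rightarrow> real"
  assumes "u \<le> v" and "\<rho> > 0"
    and d1: "\<And>x. x \<in> {u..v} \<Longrightarrow> (\<phi> has_real_derivative \<phi>' x) (at x)"
    and d2: "\<And>x. x \<in> {u..v} \<Longrightarrow> (\<phi>' has_real_derivative \<phi>'' x) (at x)"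
    and c: "continuous_on {u..v} \<phi>''" and lb: "\<And>x. x \<in> {u..v} \<Longrightarrow> \<phi>'' x \<ge> \<rho>"
  shows "norm (integral {u..v} (\<lambda>x. cis (\<phi> x))) \<le> 6 / sqrt \<rho>"
proof -
  have cont: "continuous_on {u..v} \<phi>" "continuous_on {u..v} \<phi>'"
    using real_deriv_continuous_on[of "{u..v}"] d1 d2 by auto
  have le: "3 / sqrt \<rho> \<le> 6 / sqrt \<rho>" using \<open>\<rho> > 0\<close> by (simp add: divide_right_mono)
  consider "\<phi>' u \<ge> 0" | "\<phi>' v \<le> 0" | "\<phi>' u \<le> 0" "\<phi>' v \<ge> 0" by linarith
  then show ?thesis
  proof cases
    case 1
    with integral_cis_second_derivative_right[OF assms] le show ?thesis by auto
  next
    case 2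
    with integral_cis_second_derivative_left[OF assms] le show ?thesis by auto
  next
    case 3
    then obtain x0 where x0: "u \<le> x0" "x0 \<le> v" "\<phi>' x0 = 0"
      using IVT'[of \<phi>' u 0 v] cont \<open>u \<le> v\<close> by auto
    have "norm (integral {u..x0} (\<lambda>x. cis (\<phi> x))) \<le> 3 / sqrt \<rho>"
      by (rule integral_cis_second_derivative_left[where \<phi>' = \<phi>' and \<phi>'' = \<phi>''])
        (use assms x0 in \<open>auto intro: continuous_on_subset[OF c]\<close>)
    moreover have "norm (integral {x0..v} (\<lambda>x. cis (\<phi> x))) \<le> 3 / sqrt \<rho>"
      by (rule integral_cis_second_derivative_right[where \<phi>' = \<phi>' and \<phi>'' = \<phi>''])
        (use assms x0 in \<open>auto intro: continuous_on_subset[OF c]\<close>)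
    moreover have "integral {u..v} (\<lambda>x. cis (\<phi> x)) =
        integral {u..x0} (\<lambda>x. cis (\<phi> x)) + integral {x0..v} (\<lambda>x. cis (\<phi> x))"
      by (rule Henstock_Kurzweil_Integration.integral_combine[symmetric])
        (use x0 cont(1) in \<open>auto intro!: integrable_continuous_interval continuous_on_cis\<close>)
    ultimately have "norm (integral {u..v} (\<lambda>x. cis (\<phi> x))) \<le> 3 / sqrt \<rho> + 3 / sqrt \<rho>"
      by (simp only: norm_triangle_mono)
    then show ?thesis by (simp add: add_divide_distrib[symmetric])
  qed
qed

text \<open>The number \<open>s\<close> is the sign of \<phi>''; a negative sign is removed by
  complex conjugation.\<close>

lemma integral_cis_second_derivative_abs:
  fixes \<phi> \<phi>' \<phi>'' :: "real \<Rightarrow> real"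
  assumes "u \<le> v" and "\<rho> > 0" and s: "\<bar>s\<bar> = 1"
    and d1: "\<And>x. x \<in> {u..v} \<Longrightarrow> (\<phi> has_real_derivative \<phi>' x) (at x)"
    and d2: "\<And>x. x \<in> {u..v} \<Longrightarrow> (\<phi>' has_real_derivative \<phi>'' x) (at x)"
    and c: "continuous_on {u..v} \<phi>''" and lb: "\<And>x. x \<in> {u..v} \<Longrightarrow> s * \<phi>'' x \<ge> \<rho>"
  shows "norm (integral {u..v} (\<lambda>x. cis (\<phi> x))) \<le> 6 / sqrt \<rho>"
proof (cases "s = 1")
  case True
  with integral_cis_second_derivative[OF assms(1,2) d1 d2 c] lb show ?thesis by auto
next
  case False
  hence s: "s = -1" using s by linarith
  have "norm (integral {u..v} (\<lambda>x. cis (- \<phi> x))) \<le> 6 / sqrt \<rho>"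
    by (rule integral_cis_second_derivative[where \<phi>' = "\<lambda>x. - \<phi>' x" and \<phi>'' = "\<lambda>x. - \<phi>'' x"])
      (use assms s in \<open>auto intro: continuous_on_minus DERIV_minus\<close>)
  moreover have "integral {u..v} (\<lambda>x. cis (- \<phi> x)) = cnj (integral {u..v} (\<lambda>x. cis (\<phi> x)))"
    by (simp add: integral_cnj cis_cnj)
  ultimately show ?thesis by simp
qed

text \<open>Dividing by \<phi>' is impossible where it may vanish, so the oscillating factor is
  integrated instead. Its primitive G is bounded by the second derivative test: on [X, y] the lower
  bound for |\<phi>''| is smallest at y, whence |G(y)| \<le> 6 y^e / sqrt \<rho>. As e < a, the
  integral of h' G converges at infinity, and the bound does not depend on Y.\<close>

lemma integral_cis_tail_bound:
  fixes h h' :: "real \<Rightarrow> complex" and \<phi> \<phi>' \<phi>'' :: "real \<Rightarrow> real"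
  assumes "0 < X" "X \<le> Y" and "\<rho> > 0" and s: "\<bar>s\<bar> = 1" and "e \<ge> 0" "e < a" "N \<ge> 0"
    and d1: "\<And>x. x \<in> {X..Y} \<Longrightarrow> (\<phi> has_real_derivative \<phi>' x) (at x)"
    and d2: "\<And>x. x \<in> {X..Y} \<Longrightarrow> (\<phi>' has_real_derivative \<phi>'' x) (at x)"
    and c: "continuous_on {X..Y} \<phi>''"
    and lb: "\<And>x. x \<in> {X..Y} \<Longrightarrow> s * \<phi>'' x \<ge> \<rho> * x powr (- 2 * e)"
    and dh: "\<And>x. x \<in> {X..Y} \<Longrightarrow> (h has_vector_derivative h' x) (at x)"
    and ch: "continuous_on {X..Y} h'"
    and bh: "\<And>x. x \<in> {X..Y} \<Longrightarrow> norm (h x) \<le> N * x powr (- a)"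
    and bh': "\<And>x. x \<in> {X..Y} \<Longrightarrow> norm (h' x) \<le> N * x powr (- a - 1)"
  shows "norm (integral {X..Y} (\<lambda>x. h x * cis (\<phi> x))) \<le>
    6 * N * (1 + 1 / (a - e)) / sqrt \<rho> * X powr (e - a)"
proof -
  have cont: "continuous_on {X..Y} \<phi>"
    using real_deriv_continuous_on[of "{X..Y}"] d1 by auto
  have ccis: "continuous_on {X..Y} (\<lambda>x. cis (\<phi> x))" by (intro continuous_on_cis cont)
  define G where "G = (\<lambda>y. integral {X..y} (\<lambda>x. cis (\<phi> x)))"
  have dG: "(G has_vector_derivative cis (\<phi> y)) (at y within {X..Y})" if "y \<in> {X..Y}" for y
    unfolding G_def by (rule integral_has_vector_derivative[OF ccis that])
  have G: "norm (G y) \<le> 6 / sqrt \<rho> * y powr e" if y: "y \<in> {X..Y}" for y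
  proof -
    have y0: "y > 0" using y \<open>0 < X\<close> by auto
    have "norm (G y) \<le> 6 / sqrt (\<rho> * y powr (- 2 * e))"
      unfolding G_def
    proof (rule integral_cis_second_derivative_abs[OF _ _ s, where \<phi>' = \<phi>' and \<phi>'' = \<phi>''])
      fix x assume x: "x \<in> {X..y}"
      have "y powr (- 2 * e) \<le> x powr (- 2 * e)"
        by (rule powr_mono2') (use x \<open>0 < X\<close> \<open>e \<ge> 0\<close> in auto)
      hence "\<rho> * y powr (- 2 * e) \<le> \<rho> * x powr (- 2 * e)" using \<open>\<rho> > 0\<close> by simp
      also have "\<dots> \<le> s * \<phi>'' x" using lb x y by auto
      finally show "\<rho> * y powr (- 2 * e) \<le> s * \<phi>'' x" .
    qed (use y y0 assms in \<open>auto intro: continuous_on_subset[OF c]\<close>)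
    also have "sqrt (\<rho> * y powr (- 2 * e)) = sqrt \<rho> * y powr (- e)"
      using y0 by (simp add: real_sqrt_mult powr_half_sqrt[symmetric] powr_powr)
    finally show ?thesis by (simp add: powr_minus field_simps)
  qed
  have G0: "G X = 0" by (simp add: G_def)
  have cG: "continuous_on {X..Y} G"
    using dG by (meson continuous_on_eq_continuous_within has_vector_derivative_continuous)
  have chh: "continuous_on {X..Y} h"
    using dh by (meson continuous_at_imp_continuous_on has_vector_derivative_continuous)
  have i: "(\<lambda>x. h x * cis (\<phi> x)) integrable_on {X..Y}" "(\<lambda>x. h' x * G x) integrable_on {X..Y}"
    using ccis cG chh ch by (auto intro!: integrable_continuous_interval continuous_on_mult)
  have "((\<lambda>x. h x * cis (\<phi> x) + h' x * G x) has_integral h Y * G Y - h X * G X) {X..Y}"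
    by (intro fundamental_theorem_of_calculus \<open>X \<le> Y\<close> has_vector_derivative_mult dG
        has_vector_derivative_at_within[OF dh])
  hence "integral {X..Y} (\<lambda>x. h x * cis (\<phi> x)) + integral {X..Y} (\<lambda>x. h' x * G x) = h Y * G Y"
    using integral_add[OF i] by (simp add: integral_unique G0)
  hence "integral {X..Y} (\<lambda>x. h x * cis (\<phi> x)) = h Y * G Y - integral {X..Y} (\<lambda>x. h' x * G x)"
    by (simp add: algebra_simps)
  hence "norm (integral {X..Y} (\<lambda>x. h x * cis (\<phi> x))) \<le>
      norm (h Y * G Y) + norm (integral {X..Y} (\<lambda>x. h' x * G x))"
    by (metis norm_triangle_ineq4)
  also have "norm (h Y * G Y) \<le> N * Y powr (- a) * (6 / sqrt \<rho> * Y powr e)"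
    unfolding norm_mult by (intro mult_mono bh G) (use assms in auto)
  also have "\<dots> = 6 * N / sqrt \<rho> * Y powr (e - a)"
    by (simp add: powr_diff powr_minus field_simps)
  also have "\<dots> \<le> 6 * N / sqrt \<rho> * X powr (e - a)"
    by (intro mult_left_mono powr_mono2') (use assms in auto)
  also have "norm (integral {X..Y} (\<lambda>x. h' x * G x)) \<le>
      integral {X..Y} (\<lambda>x. 6 * N / sqrt \<rho> * x powr (e - a - 1))"
  proof (rule integral_norm_bound_integral[OF i(2)])
    show "(\<lambda>x. 6 * N / sqrt \<rho> * x powr (e - a - 1)) integrable_on {X..Y}"
      using \<open>0 < X\<close> \<open>\<rho> > 0\<close> by (auto intro!: integrable_continuous_interval continuous_intros)
    fix x assume x: "x \<in> {X..Y}"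
    have "norm (h' x * G x) \<le> N * x powr (- a - 1) * (6 / sqrt \<rho> * x powr e)"
      unfolding norm_mult by (intro mult_mono bh' G x) (use assms in auto)
    also have "\<dots> = 6 * N / sqrt \<rho> * (x powr (- a - 1) * x powr e)" by simp
    also have "\<dots> = 6 * N / sqrt \<rho> * x powr (e - a - 1)"
      unfolding powr_add[symmetric] by (simp add: algebra_simps)
    finally show "norm (h' x * G x) \<le> 6 * N / sqrt \<rho> * x powr (e - a - 1)" .
  qed
  also have "\<dots> = 6 * N / sqrt \<rho> * ((X powr (e - a) - Y powr (e - a)) / (a - e))"
  proof -
    have "((\<lambda>x. x powr (e - a - 1)) has_integral Y powr (e - a) / (e - a) - X powr (e - a) / (e - a)) {X..Y}"
    proof (rule fundamental_theorem_of_calculus[OF \<open>X \<le> Y\<close>])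
      fix x assume "x \<in> {X..Y}"
      hence "((\<lambda>x. x powr (e - a) / (e - a)) has_real_derivative x powr (e - a - 1)) (at x)"
        using \<open>0 < X\<close> \<open>e < a\<close> by (auto intro!: derivative_eq_intros)
      then show "((\<lambda>x. x powr (e - a) / (e - a)) has_vector_derivative x powr (e - a - 1)) (at x within {X..Y})"
        by (metis has_field_derivative_at_within has_real_derivative_iff_has_vector_derivative)
    qed
    moreover have "Y powr (e - a) / (e - a) - X powr (e - a) / (e - a) = (X powr (e - a) - Y powr (e - a)) / (a - e)"
      using \<open>e < a\<close> by (simp add: divide_simps) (simp add: algebra_simps)
    ultimately show ?thesis by (simp add: integral_unique)
  qed
  also have "\<dots> \<le> 6 * N / sqrt \<rho> * (X powr (e - a) / (a - e))"
    by (intro mult_left_mono divide_right_mono) (use assms in auto)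
  finally have "norm (integral {X..Y} (\<lambda>x. h x * cis (\<phi> x))) \<le>
      6 * N / sqrt \<rho> * X powr (e - a) + 6 * N / sqrt \<rho> * (X powr (e - a) / (a - e))"
    by simp
  also have "\<dots> = 6 * N * (1 + 1 / (a - e)) / sqrt \<rho> * X powr (e - a)"
    by (simp add: distrib_left add_divide_distrib distrib_right)
  finally show ?thesis .
qed


subsection \<open>Integrals over the real line\<close>

lemma has_integral_jap_pos:
  assumes "\<alpha> > 1"
  shows "((\<lambda>x. 2 * jap (- \<alpha>) x) has_integral Beta (1 / 2) ((\<alpha> - 1) / 2)) {0<..}"
proof -
  define q where "q = (\<alpha> - 1) / 2"
  have q: "q > 0" using assms by (simp add: q_def)
  define f where "f = (\<lambda>t::real. t powr (1 / 2 - 1) * (1 - t) powr (q - 1))"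
  have f: "(f has_integral Beta (1 / 2) q) {0<..<1}"
    using has_integral_Beta_real[of "1/2" q] q by (simp add: f_def has_integral_Icc_iff_Ioo)
  hence fa: "f absolutely_integrable_on {0<..<1}"
    by (intro nonnegative_absolutely_integrable_1) (auto simp: f_def)
  \<comment> \<open>The substitution \<open>t = x\<^sup>2 / (1 + x\<^sup>2)\<close> turns the Beta integral into the desired one.\<close>
  define g where "g = (\<lambda>x::real. x\<^sup>2 / (1 + x\<^sup>2))"
  define g' where "g' = (\<lambda>x::real. 2 * x / (1 + x\<^sup>2)\<^sup>2)"
  have dg: "(g has_field_derivative g' x) (at x within {0<..})" for x
  proof -
    have "1 + x\<^sup>2 \<noteq> 0" using one_plus_sq_pos[of x] by linarith
    then show ?thesis unfolding g_def g'_def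
      by (auto intro!: derivative_eq_intros simp: power2_eq_square field_simps)
  qed
  have sub: "g ` {0<..} = {0<..<1}"
  proof (intro equalityI subsetI)
    fix t :: real assume t: "t \<in> {0<..<1}"
    have "t = g (sqrt (t / (1 - t)))" using t by (simp add: g_def field_simps)
    moreover have "sqrt (t / (1 - t)) \<in> {0<..}" using t by simp
    ultimately show "t \<in> g ` {0<..}" by blast
  qed (auto simp: g_def divide_simps add_pos_nonneg)
  have inj: "inj_on g {0<..}"
  proof (rule inj_onI)
    fix x y :: real assume xy: "x \<in> {0<..}" "y \<in> {0<..}" "g x = g y"
    have "1 + x\<^sup>2 \<noteq> 0" "1 + y\<^sup>2 \<noteq> 0" using one_plus_sq_pos[of x] one_plus_sq_pos[of y] by linarith+
    hence "x\<^sup>2 = y\<^sup>2" using xy(3) by (simp add: g_def divide_simps algebra_simps)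
    with xy show "x = y" by (simp add: power2_eq_iff)
  qed
  have "(\<lambda>x. \<bar>g' x\<bar> * f (g x)) absolutely_integrable_on {0<..} \<and>
      integral {0<..} (\<lambda>x. \<bar>g' x\<bar> * f (g x)) = Beta (1 / 2) q"
    by (subst has_absolute_integral_change_of_variables_1'[OF _ dg inj])
      (use fa integral_unique[OF f] sub in auto)
  hence "((\<lambda>x. \<bar>g' x\<bar> * f (g x)) has_integral Beta (1 / 2) q) {0<..}"
    using absolutely_integrable_on_def has_integral_integral by metis
  moreover have "\<bar>g' x\<bar> * f (g x) = 2 * jap (- \<alpha>) x" if "x \<in> {0<..}" for x
  proof -
    define T where "T = 1 + x\<^sup>2"
    have T: "T > 0" by (simp add: T_def)
    have x: "x > 0" using that by simp
    have "g x = (T - 1) / T" by (simp add: g_def T_def)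
    hence "1 - g x = 1 / T" using T by (simp add: field_simps)
    moreover have "(x\<^sup>2 / T) powr (1 / 2 - 1) = T powr (1/2) / x"
    proof -
      have "(x\<^sup>2 / T) powr (1 / 2 - 1) = (T / x\<^sup>2) powr (1 / 2)"
        using x T by (simp add: powr_minus_divide powr_divide)
      also have "\<dots> = T powr (1/2) / x"
        using x T by (simp add: powr_divide power2_powr_half[of x 1, simplified])
      finally show ?thesis .
    qed
    moreover have "(1 / T) powr (q - 1) = T powr (1 - q)"
      using T by (simp add: powr_divide powr_minus_divide[symmetric])
    ultimately have "\<bar>g' x\<bar> * f (g x) = 2 * x / T\<^sup>2 * (T powr (1/2) / x * T powr (1 - q))"
      using x T by (simp add: f_def g_def g'_def T_def)
    also have "\<dots> = 2 * (T powr (1/2) * T powr (1 - q) * T powr (- 2))"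
      using x T by (simp add: powr_minus powr_numeral field_simps)
    also have "\<dots> = 2 * T powr (- \<alpha> / 2)"
      by (simp add: powr_add[symmetric] q_def field_simps)
    finally show ?thesis by (simp add: jap_def T_def)
  qed
  ultimately show ?thesis
    unfolding q_def by (rule has_integral_eq[rotated])
qed

text \<open>Each half-line contributes half of the Beta value by evenness, the origin is negligible,
  and nonnegativity turns the gauge integral into a Lebesgue integral.\<close>

lemma has_bochner_integral_jap:
  assumes "\<alpha> > 1"
  shows "has_bochner_integral lborel (jap (- \<alpha>)) (Beta (1 / 2) ((\<alpha> - 1) / 2))"
proof -
  define B where "B = Beta (1 / 2) ((\<alpha> - 1) / 2)"
  have R: "(jap (- \<alpha>) has_integral B / 2) {0<..}"
    using has_integral_cmul[OF has_integral_jap_pos[OF assms], of "1/2"] by (simp add: B_def)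
  hence "jap (- \<alpha>) absolutely_integrable_on {0<..}"
    by (intro nonnegative_absolutely_integrable_1) auto
  moreover have "uminus ` {..<0} = {(0::real)<..}" by simp
  ultimately have "(\<lambda>x. \<bar>- (1::real)\<bar> * jap (- \<alpha>) (- x)) absolutely_integrable_on {..<0} \<and>
      integral {..<0} (\<lambda>x. \<bar>- (1::real)\<bar> * jap (- \<alpha>) (- x)) = B / 2"
    using integral_unique[OF R]
    by (subst has_absolute_integral_change_of_variables_1'[where g = uminus])
      (auto intro!: derivative_eq_intros simp: inj_on_def)
  hence L: "(jap (- \<alpha>) has_integral B / 2) {..<0}"
    using absolutely_integrable_on_def has_integral_integral by fastforce
  have "(jap (- \<alpha>) has_integral B / 2 + B / 2) ({..<0} \<union> {0<..})"
  proof (rule has_integral_Un[OF L R])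
    have "{..<0} \<inter> {0<..} = ({} :: real set)" by auto
    then show "negligible ({..<0} \<inter> {(0::real)<..})" by simp
  qed
  hence "(jap (- \<alpha>) has_integral B) ({..<0} \<union> {0<..})"
    by (simp only: field_sum_of_halves)
  hence "(jap (- \<alpha>) has_integral B) UNIV"
  proof (rule has_integral_spike_set_eq[THEN iffD1, rotated 2])
    show "negligible {x \<in> UNIV - ({..<0} \<union> {0<..}). jap (- \<alpha>) x \<noteq> 0}"
      by (rule negligible_subset[of "{0}"]) auto
  qed simp
  from nn_integral_has_integral_lborel[OF _ _ this]
  have nn: "(\<integral>\<^sup>+x. ennreal (jap (- \<alpha>) x) \<partial>lborel) = ennreal B" by simp
  have "B \<ge> 0" by (rule has_integral_nonneg[OF \<open>(jap (- \<alpha>) has_integral B) UNIV\<close>]) simp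
  with nn show ?thesis unfolding B_def[symmetric]
    by (intro has_bochner_integral_nn_integral) auto
qed

lemma integrable_jap: "s < -1 \<Longrightarrow> integrable lborel (jap s)"
  using has_bochner_integral_jap[of "-s"] by (simp add: has_bochner_integral_iff)

lemma integrable_jap_bound:
  fixes g :: "real \<Rightarrow> complex"
  assumes "s < -1" and "g \<in> borel_measurable borel" and "\<And>x. norm (g x) \<le> C * jap s x"
  shows "integrable lborel g"
  by (rule Bochner_Integration.integrable_bound[where f = "\<lambda>x. C * jap s x"])
    (use assms integrable_jap in \<open>auto intro!: AE_I2 order_trans[OF _ abs_ge_self]\<close>)

text \<open>The Beta value equals sqrt pi \<Gamma>((\<alpha> - 1)/2) / \<Gamma>(\<alpha>/2), the
  reciprocal of the density constant.\<close>

lemma C_const_times_integral_jap: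
  assumes "\<alpha> > 1"
  shows "C_const \<alpha> * (LINT x|lborel. jap (- \<alpha>) x) = 1" and "C_const \<alpha> > 0"
proof -
  have G: "Gamma (\<alpha> / 2) > 0" "Gamma ((\<alpha> - 1) / 2) > 0"
    using assms by (auto intro: Gamma_real_pos)
  have "1 / 2 + (\<alpha> - 1) / 2 = \<alpha> / 2" by (simp add: field_simps)
  hence "Beta (1 / 2) ((\<alpha> - 1) / 2) = sqrt pi * Gamma ((\<alpha> - 1) / 2) / Gamma (\<alpha> / 2)"
    by (simp only: Beta_def Gamma_one_half_real)
  then show "C_const \<alpha> * (LINT x|lborel. jap (- \<alpha>) x) = 1"
    using has_bochner_integral_jap[OF assms] G by (simp add: has_bochner_integral_iff C_const_def)
  show "C_const \<alpha> > 0" using G by (simp add: C_const_def)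
qed

section \<open>From gauge integrals on compact intervals to Lebesgue integrals on the line\<close>

lemma integral_eq_LINT_indicator:
  fixes g :: "real \<Rightarrow> 'a :: euclidean_space"
  assumes "integrable lborel g" and "S \<in> sets borel"
  shows "integral S g = (LINT x|lborel. indicator S x *\<^sub>R g x)"
proof -
  have "set_integrable lborel S g"
    unfolding set_integrable_def using assms by (intro integrable_mult_indicator) auto
  from set_borel_integral_eq_integral(2)[OF this] show ?thesis
    by (simp add: set_lebesgue_integral_def)
qed

lemma tendsto_integral_Icc:
  fixes g :: "real \<Rightarrow> 'a :: euclidean_space"
  assumes "integrable lborel g"
  shows "(\<lambda>n. integral {- real n..real n} g) \<longlonglongrightarrow> (LINT x|lborel. g x)"
proof -
  have "(\<lambda>n. LINT x|lborel. indicator {- real n..real n} x *\<^sub>R g x) \<longlonglongrightarrow> (LINT x|lborel. g x)"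
  proof (rule integral_dominated_convergence[where w = "\<lambda>x. norm (g x)"])
    show "AE x in lborel. (\<lambda>n. indicator {- real n..real n} x *\<^sub>R g x) \<longlonglongrightarrow> g x"
    proof (rule AE_I2)
      fix x :: real
      have "\<forall>\<^sub>F n in sequentially. indicator {- real n..real n} x *\<^sub>R g x = g x"
        using eventually_ge_at_top[of "nat \<lceil>\<bar>x\<bar>\<rceil>"]
        by eventually_elim (auto simp: nat_le_iff ceiling_le_iff abs_le_iff)
      then show "(\<lambda>n. indicator {- real n..real n} x *\<^sub>R g x) \<longlonglongrightarrow> g x"
        by (rule tendsto_eventually)
    qed
  qed (use assms in \<open>auto simp: indicator_def\<close>)
  then show ?thesis using assms by (simp add: integral_eq_LINT_indicator)
qed

lemma tendsto_integral_Icc_at_top: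
  fixes g :: "real \<Rightarrow> 'a :: euclidean_space"
  assumes "integrable lborel g"
  shows "(\<lambda>n. integral {u..real n} g) \<longlonglongrightarrow> (LINT x|lborel. indicator {u..} x *\<^sub>R g x)"
proof -
  have "(\<lambda>n. LINT x|lborel. indicator {u..real n} x *\<^sub>R g x) \<longlonglongrightarrow> (LINT x|lborel. indicator {u..} x *\<^sub>R g x)"
  proof (rule integral_dominated_convergence[where w = "\<lambda>x. norm (g x)"])
    show "AE x in lborel. (\<lambda>n. indicator {u..real n} x *\<^sub>R g x) \<longlonglongrightarrow> indicator {u..} x *\<^sub>R g x"
    proof (rule AE_I2)
      fix x :: real
      have "\<forall>\<^sub>F n in sequentially. indicator {u..real n} x *\<^sub>R g x = indicator {u..} x *\<^sub>R g x"
        using eventually_ge_at_top[of "nat \<lceil>\<bar>x\<bar>\<rceil>"]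
        by eventually_elim (auto simp: nat_le_iff ceiling_le_iff abs_le_iff indicator_def)
      then show "(\<lambda>n. indicator {u..real n} x *\<^sub>R g x) \<longlonglongrightarrow> indicator {u..} x *\<^sub>R g x"
        by (rule tendsto_eventually)
    qed
  qed (use assms in \<open>auto simp: indicator_def\<close>)
  then show ?thesis using assms by (simp add: integral_eq_LINT_indicator)
qed

text \<open>Transfers van der Corput bounds, which hold on compact intervals uniformly in their
  length, to the whole line.\<close>

lemma norm_LINT_le:
  fixes g :: "real \<Rightarrow> 'a :: euclidean_space"
  assumes "integrable lborel g" and "\<And>Y. Y \<ge> Y0 \<Longrightarrow> norm (integral {-Y..Y} g) \<le> B"
  shows "norm (LINT x|lborel. g x) \<le> B"
proof (rule tendsto_upperbound[OF tendsto_norm[OF tendsto_integral_Icc[OF assms(1)]]])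
  show "\<forall>\<^sub>F n in sequentially. norm (integral {- real n..real n} g) \<le> B"
    using eventually_ge_at_top[of "nat \<lceil>Y0\<rceil>"]
    by eventually_elim (auto intro!: assms(2) simp: nat_le_iff ceiling_le_iff)
qed simp

text \<open>Applied to a product, this is integration by parts on the line without boundary
  terms.\<close>

lemma LINT_derivative_eq_0:
  fixes G :: "real \<Rightarrow> 'a :: euclidean_space"
  assumes "\<And>x. (G has_vector_derivative g x) (at x)" and "integrable lborel g"
    and "(G \<longlongrightarrow> 0) at_top" and "(G \<longlongrightarrow> 0) at_bot"
  shows "(LINT x|lborel. g x) = 0"
proof -
  have "integral {- real n..real n} g = G (real n) - G (- real n)" for n
    by (intro integral_unique fundamental_theorem_of_calculus)
      (auto intro: has_vector_derivative_at_within assms)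
  moreover have "(\<lambda>n. G (real n) - G (- real n)) \<longlonglongrightarrow> 0 - 0"
    using filterlim_real_sequentially
    by (intro tendsto_diff filterlim_compose[OF assms(3)] filterlim_compose[OF assms(4)])
      (auto simp: filterlim_uminus_at_top)
  ultimately show ?thesis
    using LIMSEQ_unique[OF tendsto_integral_Icc[OF assms(2)]] by simp
qed

text \<open>With u a node, this expresses the point sample G(u) as an integral of G' against a step
  function.\<close>

lemma LINT_derivative_atLeast:
  fixes G :: "real \<Rightarrow> 'a :: euclidean_space"
  assumes "\<And>x. (G has_vector_derivative g x) (at x)" and "integrable lborel g"
    and "(G \<longlongrightarrow> 0) at_top"
  shows "(LINT x|lborel. indicator {u..} x *\<^sub>R g x) = - G u"
proof -
  have "\<forall>\<^sub>F n in sequentially. integral {u..real n} g = G (real n) - G u"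
    using eventually_ge_at_top[of "nat \<lceil>u\<rceil>"]
  proof eventually_elim
    case (elim n)
    then show ?case
      by (intro integral_unique fundamental_theorem_of_calculus)
        (auto intro: has_vector_derivative_at_within assms simp: nat_le_iff ceiling_le_iff)
  qed
  moreover have "(\<lambda>n. G (real n) - G u) \<longlonglongrightarrow> 0 - G u"
    by (intro tendsto_diff filterlim_compose[OF assms(3)] filterlim_real_sequentially tendsto_const)
  ultimately have "(\<lambda>n. integral {u..real n} g) \<longlonglongrightarrow> 0 - G u"
    by (simp add: tendsto_cong)
  from LIMSEQ_unique[OF tendsto_integral_Icc_at_top[OF assms(2)] this] show ?thesis by simp
qed


subsection \<open>The oscillatory integrals\<close>

text \<open>The weighted norm with m derivatives asks for symbol bounds of order -a: every
  derivative of f gains one factor \<open>jap (-1)\<close>. The functions do not depend on the phase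
  parameters, hence \<open>N\<close> serves every \<open>q\<close>.\<close>

lemma symb_derivatives:
  fixes F :: "nat \<Rightarrow> real \<Rightarrow> complex"
  assumes "\<And>l x. l < m \<Longrightarrow> (F l has_vector_derivative F (Suc l) x) (at x)"
    and "\<And>l x. l \<le> m \<Longrightarrow> norm (F l x) \<le> N * jap (- a - real l) x"
    and "continuous_on UNIV (F m)" and "N \<ge> 0"
  shows "l + n = m \<Longrightarrow> symb n D (\<lambda>q x. jap (- a - real l) x) (\<lambda>q. F l)"
proof (induction n arbitrary: l)
  case 0
  then show ?case using assms(2,4)
    by (intro symb_0I[of N]) (auto intro: continuous_on_subset[OF assms(3)])
next
  case (Suc n)
  have "symb n D (\<lambda>q x. jap (- a - real l) x * jap (-1) x) (\<lambda>q. F (Suc l))"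
  proof -
    have "- a - real l + -1 = - a - real (Suc l)" by simp
    then show ?thesis using Suc.IH[of "Suc l"] Suc.prems by (simp only: jap_mult)
  qed
  then show ?case
    by (intro symb_SucI[where C = N and u' = "\<lambda>q. F (Suc l)"] assms) (use Suc.prems in auto)
qed

lemma integral_jap_bounded:
  assumes "s < -1"
  shows "integral {u..v} (jap s) \<le> (LINT x|lborel. jap s x)"
proof -
  have "integral {u..v} (jap s) = (LINT x|lborel. indicator {u..v} x *\<^sub>R jap s x)"
    by (rule integral_eq_LINT_indicator) (use integrable_jap[OF assms] in auto)
  also have "\<dots> \<le> (LINT x|lborel. jap s x)"
    by (intro integral_mono integrable_mult_indicator integrable_jap assms)
      (auto simp: indicator_def)
  finally show ?thesis .
qed

text \<open>The sampling part \<open>L * c * jap (- \<alpha>) x\<close> of the phase derivative is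
  smallest in modulus at the ends of [-X, X], where it is 2 Om \<ge> 2 |\<eta>|. So \<eta> cannot
  cancel it, and its modulus serves as the elliptic weight \<open>P\<close>. After m rounds the
  weight is a multiple of |L|^(-m) \<open>jap (- a - m + \<alpha> * m)\<close>, integrable by
  \<open>exps\<close>.\<close>

lemma oscillatory_integral_inner:
  fixes F :: "nat \<Rightarrow> real \<Rightarrow> complex" and \<Psi> :: "real \<Rightarrow> real"
  assumes F: "\<And>l x. l < m \<Longrightarrow> (F l has_vector_derivative F (Suc l) x) (at x)"
      "\<And>l x. l \<le> m \<Longrightarrow> norm (F l x) \<le> N * jap (- a - real l) x"
      "continuous_on UNIV (F m)" "N \<ge> 0"
    and \<Psi>: "\<And>x. (\<Psi> has_real_derivative c * jap (- \<alpha>) x) (at x)" and "c > 0" "\<alpha> \<ge> 0"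
    and exps: "- a - real m + \<alpha> * real m < -1"
  shows "\<exists>C\<ge>0. \<forall>L \<eta> X Om. 1 \<le> Om \<longrightarrow> \<bar>\<eta>\<bar> \<le> Om \<longrightarrow> 0 \<le> X \<longrightarrow> \<bar>L\<bar> * c * jap (- \<alpha>) X = 2 * Om \<longrightarrow>
    norm (integral {-X..X} (\<lambda>x. F 0 x * cis (\<eta> * x + L * \<Psi> x))) \<le>
      C * (\<bar>L\<bar> powr (- real m) + jap (- a) X / Om)"
proof -
  define \<phi> where "\<phi> = (\<lambda>(L, \<eta>, X::real). \<lambda>x. \<eta> * x + L * \<Psi> x)"
  define \<phi>' where "\<phi>' = (\<lambda>(L, \<eta>, X::real). \<lambda>x. \<eta> + L * c * jap (- \<alpha>) x)"
  define P where "P = (\<lambda>(L, \<eta>::real, X::real). \<lambda>x. \<bar>L\<bar> * c * jap (- \<alpha>) x)"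
  \<comment> \<open>The term |\<eta>| in the maximum makes the phase elliptic, the term 1 gives the
    bound \<open>P \<ge> 1\<close>. The parameter Om stays out of the index: Om \<ge> 1 and Om \<ge>
    |\<eta>| already put [-X, X] inside \<open>D\<close>.\<close>
  define D where "D = (\<lambda>(L, \<eta>, X). {x. \<bar>x\<bar> \<le> X \<and> 2 * max 1 \<bar>\<eta>\<bar> \<le> \<bar>L\<bar> * c * jap (- \<alpha>) X})"
  have D: "2 * max 1 \<bar>\<eta>\<bar> \<le> P (L, \<eta>, X) x" if "x \<in> D (L, \<eta>, X)" for L \<eta> X x
  proof -
    have "2 * max 1 \<bar>\<eta>\<bar> \<le> \<bar>L\<bar> * c * jap (- \<alpha>) X" using that by (simp add: D_def)
    also have "\<dots> \<le> \<bar>L\<bar> * c * jap (- \<alpha>) x"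
      using that \<open>c > 0\<close> \<open>\<alpha> \<ge> 0\<close> by (intro mult_left_mono jap_antimono_abs) (auto simp: D_def)
    finally show ?thesis by (simp add: P_def)
  qed
  have "symb m D P (\<lambda>q x. complex_of_real (fst (snd q)) + complex_of_real (fst q * c) * of_real (jap (- \<alpha>) x))"
  proof (rule symb_add)
    show "symb m D P (\<lambda>q x. complex_of_real (fst (snd q)))"
      by (rule symb_const) (use D in \<open>fastforce simp: max_def split: if_splits\<close>)
    have "symb m D (\<lambda>q x. \<bar>fst q * c\<bar> * jap (- \<alpha>) x) (\<lambda>q x. complex_of_real (fst q * c) * of_real (jap (- \<alpha>) x))"
      by (intro symb_mult symb_const symb_jap) (simp add: norm_mult abs_mult)
    then show "symb m D P (\<lambda>q x. complex_of_real (fst q * c) * of_real (jap (- \<alpha>) x))"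
      by (rule symb_weight_cong) (use \<open>c > 0\<close> in \<open>auto simp: P_def abs_mult\<close>)
  qed
  moreover have "(\<lambda>q x. complex_of_real (fst (snd q)) + complex_of_real (fst q * c) * of_real (jap (- \<alpha>) x)) =
      (\<lambda>q x. complex_of_real (\<phi>' q x))"
    by (auto simp: \<phi>'_def fun_eq_iff)
  ultimately have s\<phi>: "symb m D P (\<lambda>q x. complex_of_real (\<phi>' q x))" by simp
  have lower: "(1 / 2) * P q x \<le> \<bar>\<phi>' q x\<bar>" if "x \<in> D q" for q x
  proof -
    obtain L \<eta> X where q: "q = (L, \<eta>, X)" by (cases q)
    have "\<bar>L * c * jap (- \<alpha>) x\<bar> = P q x" using \<open>c > 0\<close> by (simp add: q P_def abs_mult)
    moreover have "2 * \<bar>\<eta>\<bar> \<le> P q x" using D[of x L \<eta> X] that by (simp add: q)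
    ultimately show ?thesis unfolding q \<phi>'_def prod.case by linarith
  qed
  have sF: "symb m D (\<lambda>q x. jap (- a) x) (\<lambda>q. F 0)"
    using symb_derivatives[where l = 0 and n = m and D = D, OF F] by simp
  have "\<exists>C\<ge>0. \<forall>q u v. u \<le> v \<longrightarrow> {u..v} \<subseteq> D q \<longrightarrow>
    norm (integral {u..v} (\<lambda>x. F 0 x * cis (\<phi> q x))) \<le>
      C * (integral {u..v} (\<lambda>x. jap (-a) x * (jap (-1) x / P q x) ^ m) + jap (-a) u / P q u + jap (-a) v / P q v)"
  proof (rule integral_cis_by_parts_bound[OF _ s\<phi> _ lower _ _ sF])
    show "(\<phi> q has_real_derivative \<phi>' q x) (at x)" for q x
      by (cases q) (auto simp: \<phi>_def \<phi>'_def intro!: derivative_eq_intros \<Psi>)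
    show "1 \<le> P q x" if "x \<in> D q" for q x
      using D[of x "fst q" "fst (snd q)" "snd (snd q)"] that by simp
    show "continuous_on (D q) (P q)" for q
      by (cases q) (auto simp: P_def intro!: continuous_intros)
  qed (auto intro!: continuous_intros)
  then obtain C where C: "C \<ge> 0" "\<And>q u v. u \<le> v \<Longrightarrow> {u..v} \<subseteq> D q \<Longrightarrow>
    norm (integral {u..v} (\<lambda>x. F 0 x * cis (\<phi> q x))) \<le>
      C * (integral {u..v} (\<lambda>x. jap (-a) x * (jap (-1) x / P q x) ^ m) + jap (-a) u / P q u + jap (-a) v / P q v)"
    by blast
  define K where "K = c powr (- real m) * (LINT x|lborel. jap (- a - real m + \<alpha> * real m) x)"
  have K: "K \<ge> 0" by (auto simp: K_def intro!: integral_nonneg_AE)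
  have "norm (integral {-X..X} (\<lambda>x. F 0 x * cis (\<eta> * x + L * \<Psi> x))) \<le>
      (C * (K + 1)) * (\<bar>L\<bar> powr (- real m) + jap (- a) X / Om)"
    if h: "1 \<le> Om" "\<bar>\<eta>\<bar> \<le> Om" "0 \<le> X" "\<bar>L\<bar> * c * jap (- \<alpha>) X = 2 * Om" for L \<eta> X Om
  proof -
    define q where "q = (L, \<eta>, X)"
    have l0: "\<bar>L\<bar> > 0" using h(1,4) by auto
    have sub: "{-X..X} \<subseteq> D q" using h by (auto simp: q_def D_def)
    have eq: "jap (-a) x * (jap (-1) x / P q x) ^ m =
        (c powr (- real m) * \<bar>L\<bar> powr (- real m)) * jap (- a - real m + \<alpha> * real m) x" for x
    proof -
      have "jap (-1) x / P q x = (1 / (\<bar>L\<bar> * c)) * jap (\<alpha> - 1) x"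
      proof -
        have "jap (\<alpha> - 1) x = jap (-1) x / jap (- \<alpha>) x"
          using jap_divide[of "-1" x "-\<alpha>"] by simp
        then show ?thesis by (simp add: q_def P_def)
      qed
      hence "(jap (-1) x / P q x) ^ m = (1 / (\<bar>L\<bar> * c)) ^ m * jap ((\<alpha> - 1) * real m) x"
        by (simp only: power_mult_distrib jap_power)
      moreover have "(1 / (\<bar>L\<bar> * c)) ^ m = c powr (- real m) * \<bar>L\<bar> powr (- real m)"
        using l0 \<open>c > 0\<close> by (simp add: powr_minus powr_realpow field_simps)
      moreover have "jap (-a) x * jap ((\<alpha> - 1) * real m) x = jap (- a - real m + \<alpha> * real m) x"
        by (simp add: jap_mult algebra_simps)
      ultimately show ?thesis by (metis mult.left_commute)
    qed
    have "integral {-X..X} (\<lambda>x. jap (-a) x * (jap (-1) x / P q x) ^ m) =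
        (c powr (- real m) * \<bar>L\<bar> powr (- real m)) * integral {-X..X} (jap (- a - real m + \<alpha> * real m))"
      unfolding eq by simp
    also have "\<dots> \<le> (c powr (- real m) * \<bar>L\<bar> powr (- real m)) * (LINT x|lborel. jap (- a - real m + \<alpha> * real m) x)"
      by (intro mult_left_mono integral_jap_bounded exps) auto
    also have "\<dots> = K * \<bar>L\<bar> powr (- real m)" by (simp add: K_def)
    finally have I: "integral {-X..X} (\<lambda>x. jap (-a) x * (jap (-1) x / P q x) ^ m) \<le> K * \<bar>L\<bar> powr (- real m)" .
    have "norm (integral {-X..X} (\<lambda>x. F 0 x * cis (\<eta> * x + L * \<Psi> x))) \<le>
        C * (integral {-X..X} (\<lambda>x. jap (-a) x * (jap (-1) x / P q x) ^ m) + jap (-a) (-X) / P q (-X) + jap (-a) X / P q X)"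
      using C(2)[OF _ sub] h(3) by (simp add: q_def \<phi>_def)
    also have "P q (-X) = 2 * Om" using h(4) by (simp add: q_def P_def)
    also have "P q X = 2 * Om" using h(4) by (simp add: q_def P_def)
    also have "C * (integral {-X..X} (\<lambda>x. jap (-a) x * (jap (-1) x / P q x) ^ m) + jap (-a) (-X) / (2 * Om) + jap (-a) X / (2 * Om))
      \<le> C * (K * \<bar>L\<bar> powr (- real m) + jap (- a) X / Om)"
      using I C(1) by (intro mult_left_mono) (auto simp: field_simps)
    also have "\<dots> \<le> C * ((K + 1) * (\<bar>L\<bar> powr (- real m) + jap (- a) X / Om))"
    proof (intro mult_left_mono C)
      have "0 \<le> \<bar>L\<bar> powr (- real m) + K * (jap (- a) X / Om)" using K h(1) by simp
      then show "K * \<bar>L\<bar> powr (- real m) + jap (- a) X / Om \<le> (K + 1) * (\<bar>L\<bar> powr (- real m) + jap (- a) X / Om)"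
        by (simp only: distrib_left distrib_right)
    qed
    finally show ?thesis by (simp only: mult.assoc)
  qed
  moreover have "C * (K + 1) \<ge> 0" using C(1) K by simp
  ultimately show ?thesis by blast
qed

text \<open>The linear part \<eta> x drops out of the second derivative -L c \<alpha> x
  \<open>jap (- \<alpha> - 2) x\<close>. For x \<ge> 1 this has the sign of -L and modulus at least
  |L| \<rho> x^(-\<alpha> - 1), so the tail bound applies with 2 e = \<alpha> + 1 wherever
  stationary points may lie. The power of 2 in \<rho> is the price for replacing the bracket by a
  power of x.\<close>

lemma oscillatory_integral_outer:
  fixes h h' :: "real \<Rightarrow> complex" and \<phi> :: "real \<Rightarrow> real"
  assumes "c > 0" "\<alpha> > 0" "(\<alpha> + 1) / 2 < a" "N \<ge> 0" "L \<noteq> 0" "1 \<le> X" "X \<le> Y"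
    and \<phi>: "\<And>x. (\<phi> has_real_derivative \<eta> + L * (c * jap (- \<alpha>) x)) (at x)"
    and dh: "\<And>x. (h has_vector_derivative h' x) (at x)" and ch: "continuous_on UNIV h'"
    and bh: "\<And>x. norm (h x) \<le> N * jap (- a) x" and bh': "\<And>x. norm (h' x) \<le> N * jap (- a - 1) x"
  shows "norm (integral {X..Y} (\<lambda>x. h x * cis (\<phi> x))) \<le>
    6 * N * (1 + 1 / (a - (\<alpha> + 1) / 2)) / sqrt (c * \<alpha> * 2 powr (- (\<alpha> + 2) / 2)) *
      (\<bar>L\<bar> powr (- 1 / 2) * X powr ((\<alpha> + 1) / 2 - a))"
proof -
  define \<rho> where "\<rho> = c * \<alpha> * 2 powr (- (\<alpha> + 2) / 2)"
  have \<rho>: "\<rho> > 0" using assms by (simp add: \<rho>_def)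
  have "norm (integral {X..Y} (\<lambda>x. h x * cis (\<phi> x))) \<le>
    6 * N * (1 + 1 / (a - (\<alpha> + 1) / 2)) / sqrt (\<bar>L\<bar> * \<rho>) * X powr ((\<alpha> + 1) / 2 - a)"
  proof (rule integral_cis_tail_bound[where s = "- sgn L"
        and \<phi>' = "\<lambda>x. \<eta> + L * (c * jap (- \<alpha>) x)"
        and \<phi>'' = "\<lambda>x. L * (c * (- \<alpha> * x * jap (- \<alpha> - 2) x))" and h' = h'])
    fix x assume x: "x \<in> {X..Y}"
    hence x1: "x \<ge> 1" using \<open>1 \<le> X\<close> by auto
    show "((\<lambda>x. \<eta> + L * (c * jap (- \<alpha>) x)) has_real_derivative L * (c * (- \<alpha> * x * jap (- \<alpha> - 2) x))) (at x)"
      by (auto intro!: derivative_eq_intros)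
    have "x powr (- \<alpha> - 2) \<le> 2 powr ((\<alpha> + 2) / 2) * jap (- \<alpha> - 2) x"
      using powr_le_jap[of "- \<alpha> - 2" x] x1 \<open>\<alpha> > 0\<close> by (simp add: add.commute)
    hence "2 powr (- (\<alpha> + 2) / 2) * x powr (- \<alpha> - 2) \<le>
        2 powr (- (\<alpha> + 2) / 2) * (2 powr ((\<alpha> + 2) / 2) * jap (- \<alpha> - 2) x)"
      by (intro mult_left_mono) auto
    also have "\<dots> = jap (- \<alpha> - 2) x"
      by (simp add: mult.assoc[symmetric] powr_add[symmetric] add_divide_distrib[symmetric])
    finally have "2 powr (- (\<alpha> + 2) / 2) * x powr (- \<alpha> - 2) \<le> jap (- \<alpha> - 2) x" .
    hence "(\<bar>L\<bar> * c * \<alpha> * x) * (2 powr (- (\<alpha> + 2) / 2) * x powr (- \<alpha> - 2)) \<le> (\<bar>L\<bar> * c * \<alpha> * x) * jap (- \<alpha> - 2) x"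
      using assms x1 by (intro mult_left_mono) auto
    moreover have xx: "x * x powr (- \<alpha> - 2) = x powr (- 2 * ((\<alpha> + 1) / 2))"
    proof -
      have "1 + (- \<alpha> - 2) = - 2 * ((\<alpha> + 1) / 2)" by (simp add: field_simps)
      then show ?thesis using powr_add[of x 1 "- \<alpha> - 2"] x1 by (metis abs_of_nonneg order_trans powr_one zero_le_one)
    qed
    moreover have "(\<bar>L\<bar> * c * \<alpha> * x) * (2 powr (- (\<alpha> + 2) / 2) * x powr (- \<alpha> - 2)) =
        \<bar>L\<bar> * \<rho> * x powr (- 2 * ((\<alpha> + 1) / 2))"
      unfolding \<rho>_def xx[symmetric] by (simp only: mult_ac)
    ultimately have "\<bar>L\<bar> * \<rho> * x powr (- 2 * ((\<alpha> + 1) / 2)) \<le> (\<bar>L\<bar> * c * \<alpha> * x) * jap (- \<alpha> - 2) x"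
      by linarith
    also have "\<dots> = - sgn L * (L * (c * (- \<alpha> * x * jap (- \<alpha> - 2) x)))"
      by (simp add: abs_sgn mult_ac)
    finally show "\<bar>L\<bar> * \<rho> * x powr (- 2 * ((\<alpha> + 1) / 2)) \<le> - sgn L * (L * (c * (- \<alpha> * x * jap (- \<alpha> - 2) x)))" .
    show "norm (h x) \<le> N * x powr (- a)"
      using order_trans[OF bh mult_left_mono[OF jap_le_powr[of "-a" x] \<open>N \<ge> 0\<close>]] x1 assms by simp
    show "norm (h' x) \<le> N * x powr (- a - 1)"
      using order_trans[OF bh' mult_left_mono[OF jap_le_powr[of "-a-1" x] \<open>N \<ge> 0\<close>]] x1 assms by simp
  next
    show "continuous_on {X..Y} (\<lambda>x. L * (c * (- \<alpha> * x * jap (- \<alpha> - 2) x)))"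
      by (intro continuous_intros)
    show "continuous_on {X..Y} h'" using ch by (rule continuous_on_subset) auto
  qed (use assms \<rho> dh \<phi> in \<open>auto simp: sgn_if\<close>)
  also have "\<dots> = 6 * N * (1 + 1 / (a - (\<alpha> + 1) / 2)) / sqrt \<rho> * (\<bar>L\<bar> powr (- 1 / 2) * X powr ((\<alpha> + 1) / 2 - a))"
  proof -
    have "\<bar>L\<bar> powr (- 1 / 2) = 1 / sqrt \<bar>L\<bar>"
      by (simp add: powr_minus_divide powr_half_sqrt)
    then show ?thesis by (simp only: real_sqrt_mult) (simp add: mult_ac)
  qed
  finally show ?thesis by (simp only: \<rho>_def)
qed

text \<open>Inner and outer estimates are joined at a cut X that depends on |L| / Om; the lower
  bound imposed on c |L| is the condition X \<ge> 1.\<close>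

lemma oscillatory_integral_bound:
  fixes F :: "nat \<Rightarrow> real \<Rightarrow> complex" and \<Psi> :: "real \<Rightarrow> real"
  assumes F: "\<And>l x. l < m \<Longrightarrow> (F l has_vector_derivative F (Suc l) x) (at x)"
      "\<And>l x. l \<le> m \<Longrightarrow> norm (F l x) \<le> N * jap (- a - real l) x"
      "continuous_on UNIV (F m)" "N \<ge> 0" and m: "m \<ge> 2"
    and \<Psi>: "\<And>x. (\<Psi> has_real_derivative c * jap (- \<alpha>) x) (at x)"
    and "c > 0" "\<alpha> > 0" "a > 1" and a\<alpha>: "(\<alpha> + 1) / 2 < a"
    and exps: "- a - real m + \<alpha> * real m < -1"
  shows "\<exists>C\<ge>0. \<forall>L \<eta> Om. 1 \<le> Om \<longrightarrow> \<bar>\<eta>\<bar> \<le> Om \<longrightarrow> 2 * 2 powr (\<alpha> / 2) * Om \<le> c * \<bar>L\<bar> \<longrightarrow>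
    norm (LINT x|lborel. F 0 x * cis (\<eta> * x + L * \<Psi> x)) \<le>
      C * (\<bar>L\<bar> powr (- real m) + (\<bar>L\<bar> / Om) powr (- (a - 1 / 2) / \<alpha>) * Om powr (- 1 / 2))"
proof -
  obtain C1 where C1: "C1 \<ge> 0" "\<And>L \<eta> X Om. 1 \<le> Om \<Longrightarrow> \<bar>\<eta>\<bar> \<le> Om \<Longrightarrow> 0 \<le> X \<Longrightarrow>
      \<bar>L\<bar> * c * jap (- \<alpha>) X = 2 * Om \<Longrightarrow>
    norm (integral {-X..X} (\<lambda>x. F 0 x * cis (\<eta> * x + L * \<Psi> x))) \<le>
      C1 * (\<bar>L\<bar> powr (- real m) + jap (- a) X / Om)"
    using oscillatory_integral_inner[OF F \<Psi> \<open>c > 0\<close> less_imp_le[OF \<open>\<alpha> > 0\<close>] exps] by blast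
  define C2 where "C2 = 6 * N * (1 + 1 / (a - (\<alpha> + 1) / 2)) / sqrt (c * \<alpha> * 2 powr (- (\<alpha> + 2) / 2))"
  have C2: "C2 \<ge> 0" using assms unfolding C2_def
    by (intro divide_nonneg_nonneg mult_nonneg_nonneg add_nonneg_nonneg) auto
  note outer = oscillatory_integral_outer[OF \<open>c > 0\<close> \<open>\<alpha> > 0\<close> a\<alpha> \<open>N \<ge> 0\<close>, folded C2_def]
  have dF: "(F 0 has_vector_derivative F (Suc 0) x) (at x)" for x using F(1)[of 0 x] m by simp
  have cF: "continuous_on UNIV (F l)" if "l \<le> m" for l
  proof (cases "l = m")
    case False
    then show ?thesis using F(1)[of l] that
      by (intro continuous_at_imp_continuous_on ballI) (auto intro!: has_vector_derivative_continuous)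
  qed (use F(3) in simp)
  have bF: "norm (F 0 x) \<le> N * jap (- a) x" "norm (F (Suc 0) x) \<le> N * jap (- a - 1) x" for x
    using F(2)[of 0 x] F(2)[of 1 x] m by auto
  have c\<Psi>: "continuous_on UNIV \<Psi>" by (rule real_deriv_continuous_on[OF \<Psi>])
  define t where "t = (a - 1 / 2) / \<alpha>"
  \<comment> \<open>The coefficient of \<open>R\<close> in the final sum: once from the inner part
    and twice from the tails, where the extra factor is the cost of replacing \<open>V\<close> by
    \<open>R\<close>. In \<open>C\<close> the factor with c / 2 comes from T = (c / 2) (|L| /
    Om).\<close>
  define K where "K = C1 + 2 * C2 * ((2 / c) powr (- 1 / 2) * 2 powr (- ((\<alpha> + 1) / 2 - a) / 2))"
  define C where "C = C1 + K * (c / 2) powr (- t)"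
  have K0: "K \<ge> 0" using C1 C2 by (simp add: K_def)
  have C0: "C \<ge> 0" using C1 K0 by (simp add: C_def)
  have "norm (LINT x|lborel. F 0 x * cis (\<eta> * x + L * \<Psi> x)) \<le>
      C * (\<bar>L\<bar> powr (- real m) + (\<bar>L\<bar> / Om) powr (- (a - 1 / 2) / \<alpha>) * Om powr (- 1 / 2))"
    if h: "1 \<le> Om" "\<bar>\<eta>\<bar> \<le> Om" "2 * 2 powr (\<alpha> / 2) * Om \<le> c * \<bar>L\<bar>" for L \<eta> Om
  proof -
    define g where "g = (\<lambda>x. F 0 x * cis (\<eta> * x + L * \<Psi> x))"
    have L0: "\<bar>L\<bar> > 0"
    proof -
      have "0 < 2 * 2 powr (\<alpha> / 2) * Om" using h(1) by simp
      then show ?thesis using h(3) by (cases "L = 0") auto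
    qed
    \<comment> \<open>Chosen as the value of \<open>jap \<alpha> X\<close>, so that every bracket at
      X is a power of T.\<close>
    define T where "T = c * \<bar>L\<bar> / (2 * Om)"
    have T: "2 powr (\<alpha> / 2) \<le> T" using h by (simp add: T_def field_simps)
    have T0: "T > 0" using T by (rule less_le_trans[rotated]) simp
    \<comment> \<open>\<open>X\<close> is the point where the sampling phase has derivative \<open>2 Om\<close>: stationary points are beyond it.\<close>
    define X where "X = sqrt (T powr (2 / \<alpha>) - 1)"
    have "2 = (2 powr (\<alpha> / 2)) powr (2 / \<alpha>)" using \<open>\<alpha> > 0\<close> by (simp add: powr_powr)
    also have "\<dots> \<le> T powr (2 / \<alpha>)" using T \<open>\<alpha> > 0\<close> by (intro powr_mono2) auto
    finally have T2: "2 \<le> T powr (2 / \<alpha>)" .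
    hence X1: "X \<ge> 1" by (simp add: X_def)
    have X2: "1 + X\<^sup>2 = T powr (2 / \<alpha>)" using T2 by (simp add: X_def)
    have jX: "jap s X = T powr (s / \<alpha>)" for s
      by (simp add: jap_def X2 powr_powr)
    have TX: "\<bar>L\<bar> * c * jap (- \<alpha>) X = 2 * Om"
      using \<open>\<alpha> > 0\<close> T0 L0 \<open>c > 0\<close> h(1) by (simp add: jX powr_minus T_def)
    have cg: "continuous_on S g" for S
      unfolding g_def
      by (intro continuous_on_mult continuous_on_cis continuous_on_add continuous_on_const continuous_on_id
          continuous_on_subset[OF cF[of 0]] continuous_on_subset[OF c\<Psi>]) auto
    have ig: "integrable lborel g"
    proof (rule integrable_jap_bound[of "-a" g N])
      show "g \<in> borel_measurable borel"
        by (rule borel_measurable_continuous_onI[OF cg])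
    qed (use \<open>a > 1\<close> bF(1) in \<open>auto simp: g_def norm_mult\<close>)
    \<comment> \<open>The common size of the boundary terms and of the tails. The boundary terms are
      even smaller: their exponents are -a/\<alpha> for T and -1 for Om.\<close>
    define R where "R = T powr (- t) * Om powr (- 1 / 2)"
    have inner: "norm (integral {-X..X} g) \<le> C1 * (\<bar>L\<bar> powr (- real m) + R)"
    proof -
      have "jap (- a) X / Om \<le> T powr (- t) / Om"
        unfolding jX t_def using T2 X1 h(1) \<open>\<alpha> > 0\<close> T
        by (intro divide_right_mono powr_mono)
          (auto simp: divide_right_mono intro!: order_trans[OF ge_one_powr_ge_zero T])
      also have "\<dots> \<le> R"
      proof -
        have "1 / Om = Om powr (- 1)" using h(1) by (simp add: powr_minus_divide)
        also have "\<dots> \<le> Om powr (- 1 / 2)" using h(1) by (intro powr_mono) auto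
        finally have "T powr (- t) * (1 / Om) \<le> T powr (- t) * Om powr (- 1 / 2)"
          by (rule mult_left_mono) simp
        then show ?thesis by (simp add: R_def)
      qed
      finally show ?thesis
        using C1(2)[OF h(1,2) _ TX] X1 C1(1) unfolding g_def
        by (smt (verit) mult_left_mono)
    qed
    define V where "V = \<bar>L\<bar> powr (- 1 / 2) * X powr ((\<alpha> + 1) / 2 - a)"
    \<comment> \<open>Substituting |L| = (2 / c) T Om makes the exponent of T equal to -1/2 +
      ((\<alpha> + 1)/2 - a)/\<alpha> = -(a - 1/2)/\<alpha>. This is where the number a - 1/2 comes
      from.\<close>
    have V: "V \<le> ((2 / c) powr (- 1 / 2) * 2 powr (- ((\<alpha> + 1) / 2 - a) / 2)) * R"
    proof -
      have "X powr ((\<alpha> + 1) / 2 - a) \<le> 2 powr (- ((\<alpha> + 1) / 2 - a) / 2) * jap ((\<alpha> + 1) / 2 - a) X"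
        using powr_le_jap[of "(\<alpha> + 1) / 2 - a" X] X1 a\<alpha> by simp
      hence "V \<le> \<bar>L\<bar> powr (- 1 / 2) * (2 powr (- ((\<alpha> + 1) / 2 - a) / 2) * jap ((\<alpha> + 1) / 2 - a) X)"
        unfolding V_def by (rule mult_left_mono) simp
      also have "\<bar>L\<bar> = (2 / c) * (T * Om)" using h(1) \<open>c > 0\<close> by (simp add: T_def)
      also have "\<dots> powr (- 1 / 2) = (2 / c) powr (- 1 / 2) * (T powr (- 1 / 2) * Om powr (- 1 / 2))"
        by (simp only: powr_mult)
      also have "(2 / c) powr (- 1 / 2) * (T powr (- 1 / 2) * Om powr (- 1 / 2)) *
          (2 powr (- ((\<alpha> + 1) / 2 - a) / 2) * jap ((\<alpha> + 1) / 2 - a) X) =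
          ((2 / c) powr (- 1 / 2) * 2 powr (- ((\<alpha> + 1) / 2 - a) / 2)) *
          (T powr (- 1 / 2) * T powr (((\<alpha> + 1) / 2 - a) / \<alpha>) * Om powr (- 1 / 2))"
        unfolding jX by (simp only: mult_ac)
      also have "T powr (- 1 / 2) * T powr (((\<alpha> + 1) / 2 - a) / \<alpha>) = T powr (- t)"
      proof -
        have "- 1 / 2 + ((\<alpha> + 1) / 2 - a) / \<alpha> = - t"
          using \<open>\<alpha> > 0\<close> by (simp add: t_def field_simps)
        then show ?thesis by (simp only: powr_add[symmetric])
      qed
      finally show ?thesis by (simp only: R_def)
    qed
    have right: "norm (integral {X..Y} g) \<le> C2 * V" if "Y \<ge> X" for Y
      unfolding g_def V_def
      by (rule outer[where h' = "F (Suc 0)" and \<eta> = \<eta>])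
        (use L0 X1 that dF cF m bF in \<open>auto intro!: derivative_eq_intros \<Psi>\<close>)
    have left: "norm (integral {-Y..-X} g) \<le> C2 * V" if "Y \<ge> X" for Y
    proof -
      \<comment> \<open>The density is even, so reflection turns the phase into one of the same type
        with -\<eta> and -L.\<close>
      have "norm (integral {X..Y} (\<lambda>x. F 0 (- x) * cis (\<eta> * (- x) + L * \<Psi> (- x)))) \<le>
          C2 * (\<bar>- L\<bar> powr (- 1 / 2) * X powr ((\<alpha> + 1) / 2 - a))"
      proof (rule outer[where h' = "\<lambda>x. - F (Suc 0) (- x)" and \<eta> = "- \<eta>"])
        fix x
        have "((\<lambda>x. \<Psi> (- x)) has_real_derivative - (c * jap (- \<alpha>) x)) (at x)"
          using \<Psi>[of "- x"] by (simp add: DERIV_mirror)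
        then show "((\<lambda>x. \<eta> * (- x) + L * \<Psi> (- x)) has_real_derivative - \<eta> + - L * (c * jap (- \<alpha>) x)) (at x)"
          by (auto intro!: derivative_eq_intros)
        have "(uminus has_vector_derivative -1) (at x)"
          by (auto intro!: derivative_eq_intros)
        from vector_diff_chain_at[OF this dF]
        show "((\<lambda>x. F 0 (- x)) has_vector_derivative - F (Suc 0) (- x)) (at x)"
          by (simp add: o_def)
      next
        show "continuous_on UNIV (\<lambda>x. - F (Suc 0) (- x))"
          using cF[of 1] m by (auto intro!: continuous_intros continuous_on_compose2[of UNIV "F (Suc 0)"])
      qed (use L0 X1 that bF[of "- x" for x] in auto)
      then show ?thesis
        using Henstock_Kurzweil_Integration.integral_reflect_real[of Y X "\<lambda>x. g (- x)"]
        by (simp add: g_def V_def)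
    qed
    have "norm (LINT x|lborel. g x) \<le> C1 * (\<bar>L\<bar> powr (- real m) + R) + 2 * (C2 * V)"
    proof (rule norm_LINT_le[OF ig, of X])
      fix Y assume Y: "Y \<ge> X"
      have int: "g integrable_on {u..v}" for u v by (intro integrable_continuous_interval cg)
      have "integral {-Y..Y} g = integral {-Y..-X} g + integral {-X..Y} g"
        by (rule Henstock_Kurzweil_Integration.integral_combine[symmetric]) (use Y X1 int in auto)
      also have "integral {-X..Y} g = integral {-X..X} g + integral {X..Y} g"
        by (rule Henstock_Kurzweil_Integration.integral_combine[symmetric]) (use Y X1 int in auto)
      finally have "norm (integral {-Y..Y} g) \<le>
          norm (integral {-Y..-X} g) + (norm (integral {-X..X} g) + norm (integral {X..Y} g))"
        by (simp add: norm_triangle_mono norm_triangle_ineq)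
      then show "norm (integral {-Y..Y} g) \<le> C1 * (\<bar>L\<bar> powr (- real m) + R) + 2 * (C2 * V)"
        using inner left[OF Y] right[OF Y] by linarith
    qed
    also have "\<dots> \<le> C1 * (\<bar>L\<bar> powr (- real m) + R) +
        2 * (C2 * (((2 / c) powr (- 1 / 2) * 2 powr (- ((\<alpha> + 1) / 2 - a) / 2)) * R))"
      by (intro add_left_mono mult_left_mono V C2) auto
    also have "\<dots> = C1 * \<bar>L\<bar> powr (- real m) + K * R"
      by (simp add: K_def distrib_left distrib_right)
    also have "R = (c / 2) powr (- t) * ((\<bar>L\<bar> / Om) powr (- (a - 1 / 2) / \<alpha>) * Om powr (- 1 / 2))"
    proof -
      have "T = (c / 2) * (\<bar>L\<bar> / Om)" by (simp add: T_def)
      hence "T powr (- t) = (c / 2) powr (- t) * (\<bar>L\<bar> / Om) powr (- t)"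
        using \<open>c > 0\<close> L0 h(1) by (simp only: powr_mult)
      moreover have "- t = - (a - 1 / 2) / \<alpha>" by (simp only: t_def minus_divide_left)
      ultimately show ?thesis unfolding R_def by (metis mult.assoc)
    qed
    also have "C1 * \<bar>L\<bar> powr (- real m) + K * \<dots> \<le>
        C * (\<bar>L\<bar> powr (- real m) + (\<bar>L\<bar> / Om) powr (- (a - 1 / 2) / \<alpha>) * Om powr (- 1 / 2))"
    proof -
      define z where "z = (\<bar>L\<bar> / Om) powr (- (a - 1 / 2) / \<alpha>) * Om powr (- 1 / 2)"
      have "z \<ge> 0" by (simp add: z_def)
      then show ?thesis
        using C1(1) K0 unfolding z_def[symmetric] C_def
        by (simp add: distrib_left distrib_right mult.assoc add_increasing2)
    qed
    finally show ?thesis by (simp only: g_def)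
  qed
  with C0 show ?thesis by blast
qed


subsection \<open>The sampling density and its distribution function\<close>

context
  fixes c \<alpha> :: real and \<mu> :: "real \<Rightarrow> real"
  assumes \<alpha>: "\<alpha> > 1" and c: "c > 0"
    and mass: "c * (LINT x|lborel. jap (- \<alpha>) x) = 1"
    and \<mu>: "\<mu> = (\<lambda>x. c * jap (- \<alpha>) x)"
begin

lemma integrable_density: "integrable lborel \<mu>"
  unfolding \<mu> using \<alpha> by (intro integrable_mult_right integrable_jap) auto

lemma density_pos: "\<mu> x > 0"
  using c by (simp add: \<mu>)

lemma LINT_density: "(LINT x|lborel. \<mu> x) = 1"
  using mass by (simp add: \<mu>)

lemma distr_fun_density: "distr_fun \<mu> x = integral {..x} \<mu>"
  unfolding distr_fun_def set_lebesgue_integral_def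
  by (rule integral_eq_LINT_indicator[symmetric]) (use integrable_density in auto)

lemma has_real_derivative_distr_fun: "(distr_fun \<mu> has_real_derivative \<mu> x) (at x)"
proof -
  \<comment> \<open>The unbounded part of the integral is split off as a constant, which leaves the
    fundamental theorem on a compact interval around x.\<close>
  have eq: "distr_fun \<mu> (x - 1) + integral {x-1..y} \<mu> = distr_fun \<mu> y" if "y \<in> {x-1..x+1}" for y
  proof -
    have si: "set_integrable lborel S \<mu>" if "S \<in> sets borel" for S
      unfolding set_integrable_def using integrable_density that
      by (intro integrable_mult_indicator) auto
    have "\<mu> integrable_on {..x-1}" "\<mu> integrable_on {x-1..y}"
      by (intro set_borel_integral_eq_integral(1) si; simp)+
    moreover have "{..x-1} \<inter> {x-1..y} = {x - 1}" "{..x-1} \<union> {x-1..y} = {..y}" using that by auto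
    ultimately show ?thesis
      unfolding distr_fun_density using Henstock_Kurzweil_Integration.integral_Un[of \<mu> "{..x-1}" "{x-1..y}"]
      by simp
  qed
  have "((\<lambda>y. integral {x-1..y} \<mu>) has_real_derivative \<mu> x) (at x within {x-1..x+1})"
    by (rule integral_has_real_derivative) (auto simp: \<mu> intro!: continuous_intros)
  hence "((\<lambda>y. distr_fun \<mu> (x - 1) + integral {x-1..y} \<mu>) has_real_derivative \<mu> x) (at x within {x-1..x+1})"
    by (auto intro!: derivative_eq_intros)
  hence "(distr_fun \<mu> has_real_derivative \<mu> x) (at x within {x-1..x+1})"
    by (rule has_field_derivative_transform_within[OF _ zero_less_one]) (simp_all only: eq, simp)
  moreover have "at x within {x-1..x+1} = at x"
    by (rule at_within_Icc_at) auto
  ultimately show ?thesis by metis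
qed

lemma distr_fun_less: "x < y \<Longrightarrow> distr_fun \<mu> x < distr_fun \<mu> y"
  by (rule DERIV_pos_imp_increasing) (use has_real_derivative_distr_fun density_pos in blast)+

lemma distr_fun_at_top: "(distr_fun \<mu> \<longlongrightarrow> 1) at_top"
  unfolding distr_fun_def [abs_def] set_lebesgue_integral_def
  using tendsto_integral_at_top[OF _ integrable_density] by (simp add: LINT_density)

lemma distr_fun_at_bot: "(distr_fun \<mu> \<longlongrightarrow> 0) at_bot"
proof (rule tendsto_at_botI_sequentially)
  fix X :: "nat \<Rightarrow> real" assume X: "filterlim X at_bot sequentially"
  have "(\<lambda>n. LINT t|lborel. indicator {..X n} t *\<^sub>R \<mu> t) \<longlonglongrightarrow> (LINT t::real|lborel. 0)"
  proof (rule integral_dominated_convergence[where w = \<mu>])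
    show "AE t in lborel. (\<lambda>n. indicator {..X n} t *\<^sub>R \<mu> t) \<longlonglongrightarrow> 0"
    proof (rule AE_I2)
      fix t
      have "\<forall>\<^sub>F n in sequentially. X n < t"
        using X by (simp add: filterlim_at_bot_dense)
      hence "\<forall>\<^sub>F n in sequentially. indicator {..X n} t *\<^sub>R \<mu> t = 0"
        by eventually_elim auto
      then show "(\<lambda>n. indicator {..X n} t *\<^sub>R \<mu> t) \<longlonglongrightarrow> 0" by (rule tendsto_eventually)
    qed
    show "AE t in lborel. norm (indicator {..X n} t *\<^sub>R \<mu> t) \<le> \<mu> t" for n
      using less_imp_le[OF density_pos] by (auto simp: indicator_def)
  qed (use integrable_density in auto)
  then show "(\<lambda>n. distr_fun \<mu> (X n)) \<longlonglongrightarrow> 0"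
    by (simp add: distr_fun_def set_lebesgue_integral_def)
qed

lemma distr_fun_bounds: "0 < distr_fun \<mu> x" "distr_fun \<mu> x < 1"
proof -
  have le: "y \<le> z \<Longrightarrow> distr_fun \<mu> y \<le> distr_fun \<mu> z" for y z
    using distr_fun_less[of y z] by (cases "y = z") auto
  have "0 \<le> distr_fun \<mu> (x - 1)"
    by (rule tendsto_upperbound[OF distr_fun_at_bot])
      (auto intro: eventually_mono[OF eventually_le_at_bot[of "x - 1"]] le)
  then show "0 < distr_fun \<mu> x" using distr_fun_less[of "x - 1" x] by simp
  have "distr_fun \<mu> (x + 1) \<le> 1"
    by (rule tendsto_lowerbound[OF distr_fun_at_top])
      (auto intro: eventually_mono[OF eventually_ge_at_top[of "x + 1"]] le)
  then show "distr_fun \<mu> x < 1" using distr_fun_less[of x "x + 1"] by simp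
qed

lemma distr_fun_surj:
  assumes "0 < y" "y < 1"
  shows "\<exists>x. distr_fun \<mu> x = y"
proof -
  have "\<forall>\<^sub>F x in at_bot. distr_fun \<mu> x < y"
    using order_tendstoD(2)[OF distr_fun_at_bot \<open>0 < y\<close>] .
  then obtain u where u: "distr_fun \<mu> u < y"
    by (auto simp: eventually_at_bot_linorder)
  have "\<forall>\<^sub>F x in at_top. distr_fun \<mu> x > y"
    using order_tendstoD(1)[OF distr_fun_at_top \<open>y < 1\<close>] .
  then obtain v where v: "distr_fun \<mu> v > y"
    by (auto simp: eventually_at_top_linorder)
  have "u \<le> v" using u v distr_fun_less[of v u] by force
  have "continuous_on {u..v} (distr_fun \<mu>)"
    using has_real_derivative_distr_fun by (intro real_deriv_continuous_on)
  with IVT'[of "distr_fun \<mu>" u y v] u v \<open>u \<le> v\<close> show ?thesis by auto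
qed

text \<open>The midpoints (2j - 1)/(2M) lie strictly between 0 and 1, hence in the range of the
  distribution function, where \<open>inv\<close> is a true inverse and not an arbitrary
  choice.\<close>

lemma distr_fun_node:
  assumes "j \<in> {1..M}"
  shows "distr_fun \<mu> (node \<mu> M j) = (2 * real j - 1) / (2 * real M)"
proof -
  have "0 < (2 * real j - 1) / (2 * real M)" "(2 * real j - 1) / (2 * real M) < 1"
    using assms by auto
  with distr_fun_surj have "(2 * real j - 1) / (2 * real M) \<in> range (distr_fun \<mu>)" by (metis rangeI)
  then show ?thesis unfolding node_def by (rule f_inv_into_f)
qed

end

subsection \<open>Aliasing error of the transformed midpoint rule\<close>

lemma abs_pi_mult_less:
  assumes "\<bar>t\<bar> < 1 / 2"
  shows "\<bar>pi * t\<bar> < pi / 2"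
proof -
  have "pi * \<bar>t\<bar> < pi * (1 / 2)"
    using assms pi_gt_zero by (rule mult_strict_left_mono)
  moreover have "\<bar>pi * t\<bar> = pi * \<bar>t\<bar>" by (simp add: abs_mult)
  ultimately show ?thesis by linarith
qed

text \<open>Half-angle factorisation: 1 + e^(2 pi i t) = 2 cos(pi t) e^(i pi t), and the cosine is
  positive for |t| < 1/2, so the principal argument is pi t.\<close>

lemma Im_Ln_one_plus_cis:
  assumes "\<bar>t\<bar> < 1 / 2"
  shows "Im (Ln (1 + cis (2 * pi * t))) = pi * t"
proof -
  note b = abs_pi_mult_less[OF assms]
  have b': "- (pi / 2) < pi * t" "pi * t < pi / 2" using b by linarith+
  note cos = cos_gt_zero_pi[OF b']
  have "1 + cis (2 * pi * t) = of_real (2 * cos (pi * t)) * cis (pi * t)"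
    using sin_double[of "pi * t"] cos_double_cos[of "pi * t"]
    by (simp add: complex_eq_iff power2_eq_square mult.assoc mult.left_commute)
  also have "\<dots> = exp (of_real (ln (2 * cos (pi * t))) + \<i> * of_real (pi * t))"
    using cos by (simp add: exp_add exp_of_real cis_conv_exp)
  finally have "exp (of_real (ln (2 * cos (pi * t))) + \<i> * of_real (pi * t)) = 1 + cis (2 * pi * t)" ..
  from Ln_unique[OF this] b' show ?thesis using pi_gt_zero by simp
qed

text \<open>With \<open>u = M \<Psi>(t)\<close> the points \<open>j - 1/2\<close> are the nodes, so \<open>u\<close> minus the number of nodes already
  passed is the sawtooth; its Abel-summed Fourier series is the imaginary part of a logarithm.\<close>

lemma sawtooth_eq_Im_Ln:
  assumes "0 < u" "u < real M" and "\<And>j. j \<in> {1..M} \<Longrightarrow> u \<noteq> real j - 1 / 2"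
  shows "Im (Ln (1 + cis (2 * pi * u))) = pi * (u - real (card {j \<in> {1..M}. real j - 1 / 2 \<le> u}))"
    and "Re (1 + cis (2 * pi * u)) > 0"
proof -
  \<comment> \<open>The number of points j - 1/2 not exceeding u, hence t = u - N lies in [-1/2,
    1/2). The left endpoint would make u itself such a point, with N \<ge> 1 because u > 0.\<close>
  define N where "N = nat \<lfloor>u + 1 / 2\<rfloor>"
  have N: "real N \<le> u + 1 / 2" "u + 1 / 2 < real N + 1"
    using assms(1) by (auto simp: N_def)
  have NM: "N \<le> M" using N(1) assms(2) by linarith
  have "{j \<in> {1..M}. real j - 1 / 2 \<le> u} = {1..N}"
    using N NM by auto
  hence card: "card {j \<in> {1..M}. real j - 1 / 2 \<le> u} = N" by simp
  define t where "t = u - real N"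
  have "t \<noteq> - 1 / 2"
  proof
    assume "t = - 1 / 2"
    hence "u = real N - 1 / 2" by (simp add: t_def)
    moreover from this have "N \<in> {1..M}" using assms(1) NM by (cases N) auto
    ultimately show False using assms(3) by blast
  qed
  moreover have "- 1 / 2 \<le> t" "t < 1 / 2" using N unfolding t_def by linarith+
  ultimately have t: "\<bar>t\<bar> < 1 / 2" by linarith
  have "2 * pi * u = 2 * pi * t + 2 * pi * real N" by (simp add: t_def algebra_simps)
  moreover have "cis (2 * pi * real N) = 1" by (simp add: complex_eq_iff)
  ultimately have cis: "cis (2 * pi * u) = cis (2 * pi * t)"
    by (simp add: cis_mult[symmetric])
  show "Im (Ln (1 + cis (2 * pi * u))) = pi * (u - real (card {j \<in> {1..M}. real j - 1 / 2 \<le> u}))"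
    using Im_Ln_one_plus_cis[OF t] unfolding card cis by (simp add: t_def)
  note b = abs_pi_mult_less[OF t]
  have b': "- (pi / 2) < pi * t" "pi * t < pi / 2" using b by linarith+
  note cos_gt_zero_pi[OF b']
  then show "Re (1 + cis (2 * pi * u)) > 0"
    unfolding cis using cos_double_cos[of "pi * t"] by (simp add: mult.assoc)
qed

text \<open>Imaginary part of the logarithm series inside the unit disc, that is, the Abel mean of
  the sawtooth series. The term n = 0 vanishes because division by zero gives 0.\<close>

lemma sawtooth_series:
  assumes "0 \<le> r" "r < 1"
  shows "(\<lambda>n. (-1) ^ Suc n / real n * r ^ n * sin (2 * pi * real n * u)) sums
    Im (Ln (1 + of_real r * cis (2 * pi * u)))"
proof -
  have "(\<lambda>n. (-1) ^ Suc n / of_nat n * (of_real r * cis (2 * pi * u)) ^ n) sums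
      Ln (1 + of_real r * cis (2 * pi * u))"
    by (rule Ln_series) (use assms in \<open>simp add: norm_mult\<close>)
  from sums_Im[OF this] show ?thesis
  proof (rule sums_cong[THEN iffD1, rotated])
    fix n
    have Im_mult: "Im (of_real A * cis b) = A * sin b" for A b by simp
    have "(-1) ^ Suc n / of_nat n * (of_real r * cis (2 * pi * u)) ^ n =
        of_real ((-1) ^ Suc n / real n * r ^ n) * cis (2 * pi * real n * u)"
      by (simp add: power_mult_distrib Complex.DeMoivre mult_ac)
    then show "Im ((-1) ^ Suc n / of_nat n * (of_real r * cis (2 * pi * u)) ^ n) =
        (-1) ^ Suc n / real n * r ^ n * sin (2 * pi * real n * u)"
      by (simp only: Im_mult)
  qed
qed

text \<open>M times the quadrature error is the integral of the sawtooth against G'. Integrating its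
  n-th Fourier term by parts gives back the n-th cosine integral with the factor 2 pi n M, and the
  coefficient 1/n cancels n. Dividing by pi M leaves the factor 2, which accounts for the modes n
  and -n.\<close>

lemma midpoint_quadrature_error:
  fixes G G' :: "real \<Rightarrow> complex" and \<Psi> \<mu> :: "real \<Rightarrow> real" and X :: "nat \<Rightarrow> real"
  assumes M: "M \<ge> 1"
    and \<Psi>: "\<And>t. (\<Psi> has_real_derivative \<mu> t) (at t)" "\<And>s t. s < t \<Longrightarrow> \<Psi> s < \<Psi> t"
      "\<And>t. 0 < \<Psi> t" "\<And>t. \<Psi> t < 1"
    and X: "\<And>j. j \<in> {1..M} \<Longrightarrow> \<Psi> (X j) = (2 * real j - 1) / (2 * real M)"
    and dG: "\<And>t. (G has_vector_derivative G' t) (at t)"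
    and iG': "integrable lborel G'" and i\<mu>G: "integrable lborel (\<lambda>t. of_real (\<mu> t) * G t)"
    and lim: "(G \<longlongrightarrow> 0) at_top" "(G \<longlongrightarrow> 0) at_bot"
    and B: "\<And>n. n \<ge> 1 \<Longrightarrow>
        norm (LINT t|lborel. of_real (cos (2 * pi * (real n * real M) * \<Psi> t)) * (of_real (\<mu> t) * G t)) \<le> B n"
      "\<And>n. B n \<ge> 0" "summable B"
  shows "norm (1 / of_nat M * (\<Sum>j=1..M. G (X j)) - (LINT t|lborel. of_real (\<mu> t) * G t)) \<le> 2 * suminf B"
proof -
  have c\<Psi>: "continuous_on UNIV \<Psi>" by (rule real_deriv_continuous_on[OF \<Psi>(1)])
  have m\<Psi> [measurable]: "\<Psi> \<in> borel_measurable borel"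
    by (rule borel_measurable_continuous_onI[OF c\<Psi>])
  have [measurable]: "G' \<in> borel_measurable borel"
    using borel_measurable_integrable[OF iG'] by simp
  have [measurable]: "(\<lambda>t. of_real (\<mu> t) * G t) \<in> borel_measurable borel"
    using borel_measurable_integrable[OF i\<mu>G] by simp
  have ibound: "integrable lborel (\<lambda>t. of_real (h t) * k t)"
    if "h \<in> borel_measurable borel" "integrable lborel k" "\<And>t. \<bar>h t\<bar> \<le> 1"
    for h :: "real \<Rightarrow> real" and k :: "real \<Rightarrow> complex"
  proof (rule Bochner_Integration.integrable_bound[OF that(2)])
    have [measurable]: "h \<in> borel_measurable borel" "k \<in> borel_measurable borel"
      using that(1) borel_measurable_integrable[OF that(2)] by simp_all
    show "(\<lambda>t. of_real (h t) * k t) \<in> borel_measurable lborel" by measurable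
    show "AE t in lborel. norm (of_real (h t) * k t) \<le> norm (k t)"
      using that(3) by (intro AE_I2) (simp add: norm_mult mult_left_le_one_le)
  qed
  have lim0: "((\<lambda>t. of_real (h t) * G t) \<longlongrightarrow> 0) F"
    if "\<And>t. \<bar>h t\<bar> \<le> 1" "(G \<longlongrightarrow> 0) F" for h :: "real \<Rightarrow> real" and F
    by (rule Lim_null_comparison[OF _ tendsto_norm_zero[OF that(2)]])
      (use that(1) in \<open>auto simp: norm_mult intro!: always_eventually mult_left_le_one_le\<close>)
  \<comment> \<open>Here h is a function of \<Psi> and h' its derivative in that variable; the chain
    rule supplies the factor \<mu> that completes \<mu> G.\<close>
  have by_parts: "(LINT t|lborel. of_real (h t) * G' t) = - (LINT t|lborel. of_real (h' t) * (of_real (\<mu> t) * G t))"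
    if h: "\<And>t. (h has_real_derivative h' t * \<mu> t) (at t)" "\<And>t. \<bar>h t\<bar> \<le> 1"
      and i: "integrable lborel (\<lambda>t. of_real (h' t) * (of_real (\<mu> t) * G t))" for h h' :: "real \<Rightarrow> real"
  proof -
    have [measurable]: "h \<in> borel_measurable borel"
      by (rule borel_measurable_continuous_onI[OF real_deriv_continuous_on[OF h(1)]])
    have i2: "integrable lborel (\<lambda>t. of_real (h t) * G' t)" by (rule ibound[OF _ iG' h(2)]) simp
    have "(LINT t|lborel. of_real (h t) * G' t + of_real (h' t) * (of_real (\<mu> t) * G t)) = 0"
    proof (rule LINT_derivative_eq_0[where G = "\<lambda>t. of_real (h t) * G t"])
      fix t
      have "((\<lambda>t. of_real (h t) * G t) has_vector_derivative of_real (h t) * G' t + of_real (h' t * \<mu> t) * G t) (at t)"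
        by (intro has_vector_derivative_mult has_vector_derivative_of_real h dG)
      then show "((\<lambda>t. of_real (h t) * G t) has_vector_derivative
          of_real (h t) * G' t + of_real (h' t) * (of_real (\<mu> t) * G t)) (at t)"
        by (simp add: mult.assoc)
    qed (use i i2 lim0[OF h(2)] lim in auto)
    then show ?thesis
      using Bochner_Integration.integral_add[OF i2 i] by (simp add: add_eq_0_iff)
  qed
  \<comment> \<open>M \<Psi> minus the number of nodes passed. The smooth part yields -M times the
    integral of \<mu> G, and each step yields one sample.\<close>
  define s where "s = (\<lambda>t. real M * \<Psi> t - (\<Sum>j=1..M. indicator {X j..} t))"
  define I where "I = (LINT t|lborel. of_real (\<mu> t) * G t)"
  define S where "S = (\<Sum>j=1..M. G (X j))"
  have s\<Psi>: "(LINT t|lborel. of_real (\<Psi> t) * G' t) = - I"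
    using by_parts[of \<Psi> "\<lambda>_. 1"] \<Psi> i\<mu>G unfolding I_def
    by (simp add: abs_of_pos less_imp_le)
  have sj: "(LINT t|lborel. of_real (indicator {X j..} t) * G' t) = - G (X j)" for j
    using LINT_derivative_atLeast[OF dG iG' lim(1), of "X j"]
    by (simp add: scaleR_conv_of_real)
  have i\<Psi>: "integrable lborel (\<lambda>t. of_real (\<Psi> t) * G' t)"
    by (rule ibound[OF _ iG']) (use \<Psi>(3,4) in \<open>auto simp: abs_of_pos less_imp_le\<close>)
  have ij: "integrable lborel (\<lambda>t. of_real (indicator {X j..} t) * G' t)" for j
    by (rule ibound[OF _ iG']) (auto simp: indicator_def)
  have "(LINT t|lborel. of_real (s t) * G' t) =
      (LINT t|lborel. of_real (real M) * (of_real (\<Psi> t) * G' t) - (\<Sum>j=1..M. of_real (indicator {X j..} t) * G' t))"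
    by (simp add: s_def left_diff_distrib sum_distrib_right mult.assoc)
  also have "\<dots> = of_real (real M) * (LINT t|lborel. of_real (\<Psi> t) * G' t) -
      (\<Sum>j=1..M. LINT t|lborel. of_real (indicator {X j..} t) * G' t)"
    using i\<Psi> ij
    by (subst Bochner_Integration.integral_diff) (auto simp: Bochner_Integration.integral_sum)
  also have "\<dots> = S - of_nat M * I"
    unfolding s\<Psi> sj by (simp add: S_def sum_negf)
  finally have sI: "(LINT t|lborel. of_real (s t) * G' t) = S - of_nat M * I" .
  have ms [measurable]: "s \<in> borel_measurable borel" unfolding s_def by measurable
  \<comment> \<open>Abel parameters increasing to 1; \<open>A k\<close> below is the corresponding
    Abel mean of pi s, multiplied by G'.\<close>
  define r where "r = (\<lambda>k. 1 - inverse (real (Suc k)))"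
  have r: "0 \<le> r k" "r k < 1" for k by (auto simp: r_def field_simps)
  have rlim: "r \<longlonglongrightarrow> 1"
    unfolding r_def using tendsto_diff[OF tendsto_const LIMSEQ_inverse_real_of_nat, of 1] by simp
  define u where "u = (\<lambda>t. real M * \<Psi> t)"
  have mu [measurable]: "u \<in> borel_measurable borel" unfolding u_def by measurable
  define A where "A = (\<lambda>k t. complex_of_real (Im (Ln (1 + of_real (r k) * cis (2 * pi * u t)))) * G' t)"
  have nz: "1 + complex_of_real (r k) * cis y \<noteq> 0" for k y
  proof
    assume "1 + complex_of_real (r k) * cis y = 0"
    hence "complex_of_real (r k) * cis y = - 1" by (simp add: add_eq_0_iff)
    hence "norm (complex_of_real (r k) * cis y) = 1" by simp
    then show False using r[of k] by (simp add: norm_mult)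
  qed
  have A_bound: "norm (LINT t|lborel. A k t) \<le> 2 * pi * real M * suminf B" for k
  proof -
    define co where "co = (\<lambda>n. (-1) ^ Suc n / real n * r k ^ n)"
    define f where "f = (\<lambda>n t. complex_of_real (sin (2 * pi * real n * u t)) * G' t)"
    have co: "\<bar>co n\<bar> \<le> r k ^ n" for n
    proof (cases "n = 0")
      case False
      have "\<bar>co n\<bar> = r k ^ n / real n"
        using r(1)[of k] by (simp add: co_def abs_mult power_abs)
      also have "\<dots> \<le> r k ^ n / 1"
        using r(1)[of k] False by (intro divide_left_mono) auto
      finally show ?thesis by simp
    qed (simp add: co_def)
    have if_: "integrable lborel (f n)" for n
      unfolding f_def by (rule ibound[OF _ iG']) auto
    have nf: "norm (f n t) \<le> norm (G' t)" for n t
      by (simp add: f_def norm_mult mult_left_le_one_le)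
    have ncf: "norm (of_real (co n) * f n t) \<le> r k ^ n * norm (G' t)" for n t
      unfolding norm_mult using co nf r(1) by (intro mult_mono) auto
    have geo: "summable (\<lambda>n. r k ^ n * y)" for y :: real
      using r by (intro summable_mult2 summable_geometric) auto
    \<comment> \<open>Since r k < 1, the geometric majorant r^n |G'| permits integration term by
      term; for the unregularised series no such majorant exists.\<close>
    have "(\<lambda>n. LINT t|lborel. of_real (co n) * f n t) sums (LINT t|lborel. (\<Sum>n. of_real (co n) * f n t))"
    proof (rule sums_integral)
      show "integrable lborel (\<lambda>t. of_real (co n) * f n t)" for n using if_ by simp
      show "AE t in lborel. summable (\<lambda>n. norm (of_real (co n) * f n t))"
        by (intro AE_I2 summable_comparison_test'[OF geo, of 0]) (use ncf in auto)
      show "summable (\<lambda>n. LINT t|lborel. norm (of_real (co n) * f n t))"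
      proof (rule summable_comparison_test'[OF geo[of "LINT t|lborel. norm (G' t)"], of 0])
        fix n
        have "(LINT t|lborel. norm (of_real (co n) * f n t)) \<le> (LINT t|lborel. r k ^ n * norm (G' t))"
          by (intro integral_mono ncf integrable_norm integrable_mult_right if_ iG')
        then show "norm (LINT t|lborel. norm (of_real (co n) * f n t)) \<le> r k ^ n * (LINT t|lborel. norm (G' t))"
          by (simp add: integral_nonneg_AE)
      qed
    qed
    moreover have "(\<Sum>n. of_real (co n) * f n t) = A k t" for t
    proof -
      have "(\<lambda>n. of_real (co n * sin (2 * pi * real n * u t)) * G' t) sums A k t"
        unfolding A_def co_def by (intro sums_mult2 sums_of_real sawtooth_series r)
      then show ?thesis by (simp add: f_def sums_iff mult.assoc)
    qed
    ultimately have sm: "(\<lambda>n. of_real (co n) * (LINT t|lborel. f n t)) sums (LINT t|lborel. A k t)"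
      by simp
    \<comment> \<open>The factor 2 pi n M from integration by parts meets |co n| = r^n / n, which
      leaves a bound independent of the Abel parameter.\<close>
    have le: "norm (of_real (co n) * (LINT t|lborel. f n t)) \<le> 2 * pi * real M * B n" for n
    proof (cases "n = 0")
      case True
      then show ?thesis using B(2)[of n] by (simp add: co_def)
    next
      case False
      define K where "K = 2 * pi * (real n * real M)"
      have fK: "f n = (\<lambda>t. of_real (sin (K * \<Psi> t)) * G' t)"
        by (simp add: f_def u_def K_def mult.assoc)
      have icos: "integrable lborel (\<lambda>t. of_real (cos (K * \<Psi> t)) * (of_real (\<mu> t) * G t))"
        by (rule ibound[OF _ i\<mu>G]) auto
      have "(LINT t|lborel. f n t) = - (LINT t|lborel. of_real (K * cos (K * \<Psi> t)) * (of_real (\<mu> t) * G t))"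
        unfolding fK
      proof (rule by_parts)
        show "integrable lborel (\<lambda>t. of_real (K * cos (K * \<Psi> t)) * (of_real (\<mu> t) * G t))"
          using integrable_mult_right[OF icos, of "of_real K"] by (simp add: mult.assoc)
      qed (auto intro!: derivative_eq_intros \<Psi>(1))
      hence "norm (LINT t|lborel. f n t) = \<bar>K\<bar> * norm (LINT t|lborel. of_real (cos (K * \<Psi> t)) * (of_real (\<mu> t) * G t))"
        by (simp add: mult.assoc norm_mult)
      also have "\<dots> \<le> \<bar>K\<bar> * B n"
        using B(1)[of n] False by (intro mult_left_mono) (auto simp: K_def)
      finally have "\<bar>co n\<bar> * norm (LINT t|lborel. f n t) \<le> \<bar>co n\<bar> * (\<bar>K\<bar> * B n)"
        by (rule mult_left_mono) simp
      also have "\<bar>co n\<bar> * (\<bar>K\<bar> * B n) = r k ^ n * (2 * pi * real M * B n)"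
        using False r(1)[of k] by (simp add: co_def K_def abs_mult power_abs)
      also have "\<dots> \<le> 1 * (2 * pi * real M * B n)"
        using B(2) r[of k] by (intro mult_right_mono power_le_one) auto
      finally show ?thesis by (simp add: norm_mult)
    qed
    have "norm (LINT t|lborel. A k t) \<le> (\<Sum>n. 2 * pi * real M * B n)"
      using norm_suminf_le[of "\<lambda>n. of_real (co n) * (LINT t|lborel. f n t)", OF le summable_mult[OF B(3)]]
        sums_unique[OF sm] by simp
    then show ?thesis using B(3) by (simp add: suminf_mult)
  qed
  have "(\<lambda>k. LINT t|lborel. A k t) \<longlonglongrightarrow> (LINT t|lborel. of_real (pi * s t) * G' t)"
  proof (rule integral_dominated_convergence[where w = "\<lambda>t. pi * norm (G' t)"])
    \<comment> \<open>At the nodes 1 + cis vanishes and the sawtooth jumps; off this finite set the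
      real part is positive and the logarithm is continuous.\<close>
    have "AE t in lborel. t \<notin> X ` {1..M}"
      by (intro AE_not_in finite_imp_null_set_lborel) simp
    then show "AE t in lborel. (\<lambda>k. A k t) \<longlonglongrightarrow> of_real (pi * s t) * G' t"
    proof eventually_elim
      case (elim t)
      have M0: "real M > 0" using M by simp
      have uX: "u (X j) = real j - 1 / 2" if "j \<in> {1..M}" for j
        using X[OF that] M0 by (simp add: u_def field_simps)
      have u_mono: "u y \<le> u z \<longleftrightarrow> y \<le> z" for y z
        using \<Psi>(2)[of y z] \<Psi>(2)[of z y] M0 by (cases y z rule: linorder_cases) (auto simp: u_def)
      have u01: "0 < u t" "u t < real M" using \<Psi>(3,4)[of t] M0 by (auto simp: u_def)
      have ne: "u t \<noteq> real j - 1 / 2" if "j \<in> {1..M}" for j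
        using uX[OF that] u_mono[of t "X j"] u_mono[of "X j" t] elim that by force
      have "(\<Sum>j=1..M. indicator {X j..} t) = real (card {j \<in> {1..M}. real j - 1 / 2 \<le> u t})"
      proof -
        have "(\<Sum>j=1..M. indicator {X j..} t) = (\<Sum>j=1..M. if real j - 1 / 2 \<le> u t then 1 else 0 :: real)"
          by (rule sum.cong) (auto simp: indicator_def u_mono uX[symmetric])
        then show ?thesis by (simp add: sum.If_cases Int_def)
      qed
      hence "Im (Ln (1 + cis (2 * pi * u t))) = pi * s t"
        using sawtooth_eq_Im_Ln(1)[OF u01 ne] by (simp add: s_def u_def)
      moreover have "(\<lambda>k. A k t) \<longlonglongrightarrow> of_real (Im (Ln (1 + of_real 1 * cis (2 * pi * u t)))) * G' t"
        unfolding A_def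
        by (intro tendsto_intros rlim)
          (use sawtooth_eq_Im_Ln(2)[OF u01 ne] in \<open>auto simp: complex_nonpos_Reals_iff\<close>)
      ultimately show ?case by simp
    qed
    show "AE t in lborel. norm (A k t) \<le> pi * norm (G' t)" for k
    proof (rule AE_I2)
      fix t
      have "\<bar>Im (Ln (1 + of_real (r k) * cis (2 * pi * u t)))\<bar> \<le> pi"
        using mpi_less_Im_Ln[OF nz] Im_Ln_le_pi[OF nz] by (auto simp: abs_le_iff less_imp_le minus_le_iff)
      then show "norm (A k t) \<le> pi * norm (G' t)"
        by (simp add: A_def norm_mult mult_right_mono)
    qed
    show "A k \<in> borel_measurable lborel" for k
    proof -
      have "continuous_on UNIV (\<lambda>y. Im (Ln (1 + of_real (r k) * cis y)))"
      proof (intro continuous_intros)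
        fix y
        have "Re (1 + of_real (r k) * cis y) > 0"
        proof -
          have "\<bar>r k * cos y\<bar> \<le> r k" using r(1)[of k] by (simp add: abs_mult mult_left_le)
          then show ?thesis using r(2)[of k] by simp
        qed
        then show "1 + of_real (r k) * cis y \<notin> \<real>\<^sub>\<le>\<^sub>0" by (auto simp: complex_nonpos_Reals_iff)
      qed
      from borel_measurable_continuous_onI[OF this]
      have "(\<lambda>y. Im (Ln (1 + of_real (r k) * cis y))) \<in> borel_measurable borel" .
      from measurable_compose[OF _ this, of "\<lambda>t. 2 * pi * u t" lborel]
      show ?thesis unfolding A_def by simp
    qed
  qed (use iG' in auto)
  hence "norm (LINT t|lborel. of_real (pi * s t) * G' t) \<le> 2 * pi * real M * suminf B"
    by (intro LIMSEQ_le_const2[OF tendsto_norm]) (use A_bound in auto)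
  also have "(LINT t|lborel. of_real (pi * s t) * G' t) = of_real pi * (S - of_nat M * I)"
    by (simp add: mult.assoc flip: sI)
  finally have "pi * norm (S - of_nat M * I) \<le> pi * (2 * real M * suminf B)"
    by (simp add: norm_mult mult_ac)
  hence *: "norm (S - of_nat M * I) \<le> 2 * real M * suminf B" by simp
  have "1 / of_nat M * S - I = (S - of_nat M * I) / of_nat M"
    using M by (simp add: field_simps)
  also have "norm \<dots> \<le> 2 * suminf B"
    using * M by (simp add: norm_divide field_simps)
  finally show ?thesis by (simp only: S_def I_def)
qed


subsection \<open>Uniform and \<open>L\<^sub>p\<close> error bounds\<close>

text \<open>Every summand of the norm is at most the whole sum; dividing by the weights gives the
  decay that \<open>symb_derivatives\<close> expects.\<close>

lemma space_Fm_derivatives: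
  assumes "f \<in> space_Fm (jap a) m"
  obtains N where "N \<ge> 0"
    "\<And>l x. l < m \<Longrightarrow> (nth_deriv l f has_vector_derivative nth_deriv (Suc l) f x) (at x)"
    "\<And>l x. l \<le> m \<Longrightarrow> norm (nth_deriv l f x) \<le> N * jap (- a - real l) x"
    "continuous_on UNIV (nth_deriv m f)"
proof -
  define N where "N = enn2real (norm_Fm (jap a) m f)"
  have cd: "cont_diff m f" and fin: "norm_Fm (jap a) m f < \<infinity>"
    using assms by (auto simp: space_Fm_def)
  have d: "(nth_deriv l f has_vector_derivative nth_deriv (Suc l) f x) (at x)" if "l < m" for l x
    using cd that by (simp add: cont_diff_def nth_deriv_def vector_derivative_works)
  have b: "norm (nth_deriv l f x) \<le> N * jap (- a - real l) x" if "l \<le> m" for l x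
  proof -
    have "ennreal ((\<Sum>l\<le>m. norm (nth_deriv l f x) * (1 + \<bar>x\<bar>\<^sup>2) powr (real l / 2)) * jap a x)
        \<le> norm_Fm (jap a) m f"
      unfolding norm_Fm_def by (rule SUP_upper) simp
    from enn2real_mono[OF this] fin
    have "(\<Sum>l\<le>m. norm (nth_deriv l f x) * (1 + \<bar>x\<bar>\<^sup>2) powr (real l / 2)) * jap a x \<le> N"
      by (simp add: N_def sum_nonneg)
    moreover have "norm (nth_deriv l f x) * (1 + \<bar>x\<bar>\<^sup>2) powr (real l / 2) \<le>
        (\<Sum>l\<le>m. norm (nth_deriv l f x) * (1 + \<bar>x\<bar>\<^sup>2) powr (real l / 2))"
      by (rule member_le_sum) (use that in auto)
    ultimately have "norm (nth_deriv l f x) * (1 + \<bar>x\<bar>\<^sup>2) powr (real l / 2) * jap a x \<le> N"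
      by (rule order_trans[OF mult_right_mono, rotated 2]) simp
    hence "norm (nth_deriv l f x) * jap (real l) x * jap a x \<le> N" by (simp add: jap_def)
    hence "norm (nth_deriv l f x) * jap (real l + a) x * jap (- a - real l) x \<le> N * jap (- a - real l) x"
      by (intro mult_right_mono) (auto simp: jap_mult mult.assoc)
    then show ?thesis by (simp add: mult.assoc jap_mult)
  qed
  show thesis by (rule that[of N]) (use d b cd in \<open>auto simp: cont_diff_def N_def\<close>)
qed

lemma space_F_bound:
  assumes "g \<in> space_F (jap b)"
  obtains N where "N \<ge> 0" "\<And>x. norm (g x) \<le> N * jap (- b) x" "continuous_on UNIV g"
proof -
  define N where "N = enn2real (norm_F (jap b) g)"
  have c: "continuous_on UNIV g" and fin: "norm_F (jap b) g < \<infinity>"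
    using assms by (auto simp: space_F_def)
  have "norm (g x) \<le> N * jap (- b) x" for x
  proof -
    have "ennreal (norm (g x) * jap b x) \<le> norm_F (jap b) g"
      unfolding norm_F_def by (rule SUP_upper) simp
    from enn2real_mono[OF this] fin have "norm (g x) * jap b x \<le> N" by (simp add: N_def)
    hence "norm (g x) * jap b x * jap (- b) x \<le> N * jap (- b) x" by (rule mult_right_mono) simp
    then show ?thesis by (simp add: mult.assoc jap_mult)
  qed
  then show thesis by (intro that[of N]) (auto simp: c N_def)
qed

lemma jap_tendsto_0:
  assumes "s < 0"
  shows "(jap s \<longlongrightarrow> 0) at_top" "(jap s \<longlongrightarrow> 0) at_bot"
proof -
  show top: "(jap s \<longlongrightarrow> 0) at_top"
  proof (rule tendsto_sandwich[of "\<lambda>_. 0" _ _ "\<lambda>x. x powr s"])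
    show "\<forall>\<^sub>F x in at_top. jap s x \<le> x powr s"
      using eventually_gt_at_top[of 0] 
    proof eventually_elim
      case (elim x)
      with jap_le_powr[of s x] assms show ?case by simp
    qed
    show "((\<lambda>x. x powr s) \<longlongrightarrow> 0) at_top"
      using assms by (intro tendsto_neg_powr filterlim_ident)
  qed auto
  show "(jap s \<longlongrightarrow> 0) at_bot"
    unfolding filterlim_at_bot_mirror using top by simp
qed

text \<open>The hypothesis \<open>rate\<close> is the equation that determines \<alpha>: for L of
  order n M and Om of order M^(m/b), it says that the outer part of the oscillatory bound has
  M-power -m.\<close>

lemma sup_error_bound:
  fixes a b \<alpha> c :: real and f :: "real \<Rightarrow> complex" and \<mu> :: "real \<Rightarrow> real"
  assumes "2 \<le> m" "real m < b" "b > 1"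
    and f: "f \<in> space_Fm (jap a) m"
    and \<alpha>: "\<alpha> > 1" "\<alpha> * real m < a - 1 / 2"
    and rate: "(1 - real m / b) * ((a - 1 / 2) / \<alpha>) + real m / (2 * b) = real m"
    and c: "c > 0" "c * (LINT x|lborel. jap (- \<alpha>) x) = 1"
    and \<mu>: "\<mu> = (\<lambda>x. c * jap (- \<alpha>) x)"
  shows "\<exists>C\<ge>0. \<forall>\<^sub>F M in sequentially. \<forall>\<xi>. \<bar>\<xi>\<bar> \<le> real M powr (real m / b) \<longrightarrow>
    norm (fourier f \<xi> - approx_ft \<mu> (real M powr (real m / b)) M f \<xi>) \<le> C * real M powr (- real m)"
proof -
  obtain N where N: "N \<ge> 0"
    and dF: "\<And>l x. l < m \<Longrightarrow> (nth_deriv l f has_vector_derivative nth_deriv (Suc l) f x) (at x)"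
    and bF: "\<And>l x. l \<le> m \<Longrightarrow> norm (nth_deriv l f x) \<le> N * jap (- a - real l) x"
    and cF: "continuous_on UNIV (nth_deriv m f)"
    using space_Fm_derivatives[OF f] by blast
  have f0: "nth_deriv 0 f = f" by (simp add: nth_deriv_def)
  define f' where "f' = nth_deriv (Suc 0) f"
  have df: "(f has_vector_derivative f' x) (at x)" for x
    using dF[of 0 x] \<open>2 \<le> m\<close> by (simp add: f0 f'_def)
  have cf: "continuous_on UNIV f"
    using df by (intro continuous_at_imp_continuous_on ballI) (blast intro: has_vector_derivative_continuous)
  have df': "(f' has_vector_derivative nth_deriv (Suc (Suc 0)) f x) (at x)" for x
    using dF[of 1 x] \<open>2 \<le> m\<close> by (simp add: f'_def)
  have cf': "continuous_on UNIV f'"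
    using df' by (intro continuous_at_imp_continuous_on ballI) (blast intro: has_vector_derivative_continuous)
  have bf: "norm (f x) \<le> N * jap (- a) x" "norm (f' x) \<le> N * jap (- a - 1) x" for x
    using bF[of 0 x] bF[of 1 x] \<open>2 \<le> m\<close> by (auto simp: f0 f'_def)
  \<comment> \<open>Two derivatives give 2 \<alpha> < a - 1/2. This covers the integrability of G'
    (\<alpha> - a < -1), the convergence of the tails ((\<alpha> + 1)/2 < a) and q > 1.\<close>
  have "\<alpha> * 2 \<le> \<alpha> * real m" using \<alpha>(1) \<open>2 \<le> m\<close> by simp
  hence \<alpha>a: "2 * \<alpha> < a - 1 / 2" using \<alpha>(2) by linarith
  have a: "a > 1" "\<alpha> - a < -1" "(\<alpha> + 1) / 2 < a" using \<alpha>a \<alpha>(1) by auto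
  have exps: "- a - real m + \<alpha> * real m < -1" using \<alpha>(2) \<open>2 \<le> m\<close> by linarith
  define q where "q = (a - 1 / 2) / \<alpha>"
  have q: "q > 1" using \<alpha>a \<alpha>(1) by (simp add: q_def)
  note distr = has_real_derivative_distr_fun[OF \<alpha>(1) c \<mu>] distr_fun_less[OF \<alpha>(1) c \<mu>]
    distr_fun_bounds[OF \<alpha>(1) c \<mu>]
  define \<Psi> where "\<Psi> = distr_fun \<mu>"
  have d\<Psi>: "(\<Psi> has_real_derivative c * jap (- \<alpha>) x) (at x)" for x
    using distr(1) by (simp add: \<Psi>_def \<mu>)
  have c\<Psi>: "continuous_on UNIV \<Psi>" by (rule real_deriv_continuous_on[OF d\<Psi>])
  obtain C where C: "C \<ge> 0" "\<And>L \<eta> Om. 1 \<le> Om \<Longrightarrow> \<bar>\<eta>\<bar> \<le> Om \<Longrightarrow> 2 * 2 powr (\<alpha> / 2) * Om \<le> c * \<bar>L\<bar> \<Longrightarrow>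
    norm (LINT x|lborel. f x * cis (\<eta> * x + L * \<Psi> x)) \<le>
      C * (\<bar>L\<bar> powr (- real m) + (\<bar>L\<bar> / Om) powr (- (a - 1 / 2) / \<alpha>) * Om powr (- 1 / 2))"
    using oscillatory_integral_bound[OF dF bF cF N \<open>2 \<le> m\<close> d\<Psi> c(1) _ a(1) a(3) exps] \<alpha>(1)
    unfolding f0 by auto
  define Z where "Z = (\<Sum>n. real n powr (- real m) + real n powr (- q))"
  have sZ: "summable (\<lambda>n. real n powr (- real m) + real n powr (- q))"
    using q \<open>2 \<le> m\<close> by (intro summable_add) (auto simp: summable_real_powr_iff)
  have Z0: "Z \<ge> 0" unfolding Z_def by (intro suminf_nonneg sZ) auto
  define s where "s = real m / b"
  have s: "0 < s" "s < 1" using assms(1-3) by (auto simp: s_def)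
  \<comment> \<open>As m/b < 1, the band grows more slowly than M. From some M on, already the first
    mode n = 1 satisfies the size condition of the oscillatory bound, and larger n satisfy it all
    the more.\<close>
  have ev: "\<forall>\<^sub>F M in sequentially. 1 \<le> M \<and> 2 * 2 powr (\<alpha> / 2) * real M powr s \<le> c * real M"
  proof -
    have "((\<lambda>M. real M powr (s - 1)) \<longlongrightarrow> 0) sequentially"
      using s by (intro tendsto_neg_powr filterlim_real_sequentially) auto
    moreover have "0 < c / (2 * 2 powr (\<alpha> / 2))" using c(1) by simp
    ultimately have "\<forall>\<^sub>F M in sequentially. real M powr (s - 1) < c / (2 * 2 powr (\<alpha> / 2))"
      by (rule order_tendstoD)
    then show ?thesis using eventually_ge_at_top[of 1]
    proof eventually_elim
      case (elim M)
      hence "2 * 2 powr (\<alpha> / 2) * real M powr (s - 1) \<le> c" by (simp add: field_simps)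
      hence "2 * 2 powr (\<alpha> / 2) * real M powr (s - 1) * real M \<le> c * real M"
        by (rule mult_right_mono) simp
      moreover have "real M powr (s - 1) * real M = real M powr s"
        using elim by (simp add: powr_diff)
      ultimately show ?case using elim by (simp add: mult.assoc)
    qed
  qed
  have main: "norm (fourier f \<xi> - approx_ft \<mu> (real M powr s) M f \<xi>) \<le> (2 * C * Z) * real M powr (- real m)"
    if M: "1 \<le> M" "2 * 2 powr (\<alpha> / 2) * real M powr s \<le> c * real M" and \<xi>: "\<bar>\<xi>\<bar> \<le> real M powr s" for M \<xi>
  proof -
    define \<eta> where "\<eta> = - 2 * pi * \<xi>"
    define e where "e = (\<lambda>x. cis (\<eta> * x))"
    \<comment> \<open>The sampled function f e / \<mu>: its average over the nodes is the
      approximation, and the integral of \<mu> G is the Fourier transform.\<close>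
    define G where "G = (\<lambda>x. of_real (jap \<alpha> x / c) * (f x * e x))"
    define G' where "G' = (\<lambda>x. of_real (jap \<alpha> x / c) * (f x * (\<i> * of_real \<eta> * e x) + f' x * e x)
        + of_real (\<alpha> * x * jap (\<alpha> - 2) x / c) * (f x * e x))"
    have exp_e: "exp (- (2 * of_real pi * \<i> * of_real x * of_real \<xi>)) = e x"
      "exp (- (2 * of_real pi * \<i> * of_real \<xi> * of_real x)) = e x" for x
      by (simp_all add: e_def \<eta>_def cis_conv_exp mult_ac)
    have ne: "norm (e x) = 1" for x by (simp add: e_def)
    have de: "(e has_vector_derivative \<i> * of_real \<eta> * e x) (at x)" for x
      unfolding e_def by (rule has_vector_derivative_cis) (auto intro!: derivative_eq_intros)
    have ce: "continuous_on UNIV e" unfolding e_def by (intro continuous_on_cis continuous_intros)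
    have \<mu>G: "of_real (\<mu> x) * G x = f x * e x" for x
    proof -
      have "\<mu> x * (jap \<alpha> x / c) = 1" using c(1) by (simp add: \<mu> jap_mult)
      hence "complex_of_real (\<mu> x) * of_real (jap \<alpha> x / c) = 1" by (metis of_real_1 of_real_mult)
      then show ?thesis unfolding G_def by (simp only: mult.assoc[symmetric] mult_1)
    qed
    have four: "fourier f \<xi> = (LINT x|lborel. of_real (\<mu> x) * G x)"
      by (simp add: fourier_def exp_e \<mu>G)
    have appr: "approx_ft \<mu> (real M powr s) M f \<xi> = 1 / of_nat M * (\<Sum>j=1..M. G (node \<mu> M j))"
    proof -
      have "f x / of_real (\<mu> x) * e x = G x" for x
      proof -
        have "complex_of_real (\<mu> x) \<noteq> 0" using c(1) by (simp add: \<mu>)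
        with \<mu>G[of x] show ?thesis by (simp add: field_simps)
      qed
      then show ?thesis using \<xi> by (simp add: approx_ft_def exp_e)
    qed
    have dG: "(G has_vector_derivative G' x) (at x)" for x
      unfolding G_def G'_def
      by (intro has_vector_derivative_mult has_vector_derivative_of_real de df)
        (use c(1) in \<open>auto intro!: derivative_eq_intros\<close>)
    \<comment> \<open>This constant grows with \<xi>, which is harmless: it only serves to show that
      G' is integrable and never enters the error bound.\<close>
    define K where "K = N * (\<bar>\<eta>\<bar> + 1 + \<alpha>) / c"
    have bG: "norm (G x) \<le> N / c * jap (\<alpha> - a) x" for x
    proof -
      have "norm (G x) = jap \<alpha> x / c * norm (f x)" using c(1) by (simp add: G_def norm_mult norm_divide ne)
      also have "\<dots> \<le> jap \<alpha> x / c * (N * jap (- a) x)"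
        using c(1) bf(1) by (intro mult_left_mono) auto
      also have "\<dots> = N / c * (jap \<alpha> x * jap (- a) x)" by simp
      finally show ?thesis by (simp only: jap_mult) simp
    qed
    have bG': "norm (G' x) \<le> K * jap (\<alpha> - a) x" for x
    proof -
      have 1: "norm (of_real (jap \<alpha> x / c) * (f x * (\<i> * of_real \<eta> * e x) + f' x * e x)) \<le>
          jap \<alpha> x / c * ((N * jap (- a) x) * \<bar>\<eta>\<bar> + N * jap (- a) x)"
      proof -
        have "norm (f x * (\<i> * of_real \<eta> * e x) + f' x * e x) \<le> norm (f x) * \<bar>\<eta>\<bar> + norm (f' x)"
          by (rule norm_triangle_le) (simp add: norm_mult ne)
        also have "\<dots> \<le> (N * jap (- a) x) * \<bar>\<eta>\<bar> + N * jap (- a) x"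
        proof (intro add_mono mult_right_mono bf)
          have "N * jap (- a - 1) x \<le> N * jap (- a) x" by (intro mult_left_mono jap_mono N) auto
          with bf(2) show "norm (f' x) \<le> N * jap (- a) x" by (rule order_trans)
        qed auto
        finally have "jap \<alpha> x / c * norm (f x * (\<i> * of_real \<eta> * e x) + f' x * e x) \<le>
            jap \<alpha> x / c * ((N * jap (- a) x) * \<bar>\<eta>\<bar> + N * jap (- a) x)"
          using c(1) by (intro mult_left_mono) auto
        then show ?thesis using c(1) by (simp add: norm_mult norm_divide)
      qed
      have 2: "norm (of_real (\<alpha> * x * jap (\<alpha> - 2) x / c) * (f x * e x)) \<le> jap \<alpha> x / c * (\<alpha> * (N * jap (- a) x))"
      proof -
        have "\<bar>x\<bar> * jap (\<alpha> - 2) x \<le> jap 1 x * jap (\<alpha> - 2) x"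
          by (intro mult_right_mono abs_le_jap) simp
        also have "\<dots> \<le> jap \<alpha> x" unfolding jap_mult by (rule jap_mono) simp
        finally have "(\<bar>x\<bar> * jap (\<alpha> - 2) x) * (\<alpha> / c) * norm (f x) \<le> jap \<alpha> x * (\<alpha> / c) * (N * jap (- a) x)"
          using \<alpha>(1) c(1) bf(1) N by (intro mult_mono) auto
        then show ?thesis using \<alpha>(1) c(1) by (simp add: norm_mult norm_divide abs_mult ne mult_ac)
      qed
      have "norm (G' x) \<le> jap \<alpha> x / c * ((N * jap (- a) x) * \<bar>\<eta>\<bar> + N * jap (- a) x)
          + jap \<alpha> x / c * (\<alpha> * (N * jap (- a) x))"
        unfolding G'_def by (rule norm_triangle_mono[OF 1 2])
      also have "\<dots> = K * (jap \<alpha> x * jap (- a) x)" by (simp add: K_def add_divide_distrib distrib_left distrib_right mult_ac)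
      finally show ?thesis by (simp only: jap_mult) simp
    qed
    have cG': "continuous_on UNIV G'"
      unfolding G'_def by (intro continuous_intros cf cf' ce) (use c(1) in auto)
    have iG': "integrable lborel G'"
      by (rule integrable_jap_bound[OF a(2) borel_measurable_continuous_onI[OF cG'] bG'])
    have ifc: "integrable lborel (\<lambda>x. f x * cis (h x))" if "continuous_on UNIV h" for h
    proof (rule integrable_jap_bound[of "- a"])
      show "(\<lambda>x. f x * cis (h x)) \<in> borel_measurable borel"
        by (intro borel_measurable_continuous_onI continuous_on_mult cf continuous_on_cis that)
    qed (use a(1) bf(1) in \<open>auto simp: norm_mult\<close>)
    have limG: "(G \<longlongrightarrow> 0) F" if "(jap (\<alpha> - a) \<longlongrightarrow> 0) F" for F
      by (rule Lim_null_comparison[OF _ tendsto_mult_right_zero[OF that, of "N / c"]]) (use bG in simp)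
    define B where "B = (\<lambda>n. C * real M powr (- real m) * (real n powr (- real m) + real n powr (- q)))"
    have M0: "real M > 0" using M(1) by simp
    have Bn: "norm (LINT t|lborel. of_real (cos (2 * pi * (real n * real M) * \<Psi> t)) * (of_real (\<mu> t) * G t)) \<le> B n"
      if n: "n \<ge> 1" for n
    proof -
      define L where "L = 2 * pi * (real n * real M)"
      \<comment> \<open>The factor 2 pi makes Om a bound for the angular frequency |\<eta>| = 2 pi
        |\<xi>|.\<close>
      define Om where "Om = 2 * pi * real M powr s"
      have n0: "real n > 0" using n by simp
      have L0: "L > 0" using n0 M0 by (simp add: L_def)
      have pi1: "1 \<le> 2 * pi" using pi_gt3 by linarith
      have Ms: "1 \<le> real M powr s" using M(1) s(1) by (intro ge_one_powr_ge_zero) auto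
      have Om: "real M powr s \<le> Om" "1 \<le> Om"
        using mult_right_mono[OF pi1, of "real M powr s"] Ms unfolding Om_def by linarith+
      have \<eta>: "\<bar>\<eta>\<bar> \<le> Om" using \<xi> by (simp add: \<eta>_def Om_def abs_mult)
      have big: "2 * 2 powr (\<alpha> / 2) * Om \<le> c * L"
      proof -
        have "2 * 2 powr (\<alpha> / 2) * Om = 2 * pi * (2 * 2 powr (\<alpha> / 2) * real M powr s)"
          by (simp add: Om_def)
        also have "\<dots> \<le> 2 * pi * (c * real M)" by (intro mult_left_mono M) auto
        also have "\<dots> \<le> 2 * pi * (c * real M) * real n"
        proof -
          have "0 \<le> 2 * pi * (c * real M)" using c(1) by simp
          from mult_left_mono[OF _ this, of 1 "real n"] n show ?thesis by simp
        qed
        finally show ?thesis by (simp add: L_def mult_ac)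
      qed
      \<comment> \<open>Here |L| / Om = n M^(1 - s) and Om \<ge> M^s, so the second term has M-power
        -(1 - s) q - s/2, which is -m by \<open>rate\<close>.\<close>
      have le: "\<bar>L\<bar> powr (- real m) + (\<bar>L\<bar> / Om) powr (- (a - 1 / 2) / \<alpha>) * Om powr (- 1 / 2)
          \<le> real M powr (- real m) * (real n powr (- real m) + real n powr (- q))"
      proof -
        have "real n * real M \<le> L"
          using mult_right_mono[OF pi1, of "real n * real M"] unfolding L_def by simp
        hence "\<bar>L\<bar> powr (- real m) \<le> (real n * real M) powr (- real m)"
          using L0 n0 M0 by (intro powr_mono2') auto
        also have "\<dots> = real M powr (- real m) * real n powr (- real m)"
          by (simp only: powr_mult mult.commute)
        finally have 1: "\<bar>L\<bar> powr (- real m) \<le> real M powr (- real m) * real n powr (- real m)" .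
        have "\<bar>L\<bar> / Om = real n * real M powr (1 - s)"
          using L0 M0 by (simp add: L_def Om_def powr_diff)
        hence e1: "(\<bar>L\<bar> / Om) powr (- (a - 1 / 2) / \<alpha>) = real n powr (- q) * real M powr ((1 - s) * (- q))"
          by (simp only: powr_mult powr_powr q_def minus_divide_left)
        have e2: "Om powr (- 1 / 2) \<le> real M powr (s * (- 1 / 2))"
          unfolding powr_powr[symmetric] using Om M0 by (intro powr_mono2') auto
        have "(\<bar>L\<bar> / Om) powr (- (a - 1 / 2) / \<alpha>) * Om powr (- 1 / 2) \<le>
            real n powr (- q) * real M powr ((1 - s) * (- q)) * real M powr (s * (- 1 / 2))"
          unfolding e1 by (intro mult_left_mono e2) simp
        also have "\<dots> = real n powr (- q) * real M powr ((1 - s) * (- q) + s * (- 1 / 2))"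
          by (simp only: powr_add mult.assoc)
        also have "(1 - s) * (- q) + s * (- 1 / 2) = - real m"
          using rate unfolding s_def q_def by (simp add: algebra_simps)
        finally show ?thesis using 1 by (simp add: distrib_left mult.commute)
      qed
      have osc: "norm (LINT x|lborel. f x * cis (\<eta> * x + L' * \<Psi> x)) \<le> B n" if "\<bar>L'\<bar> = L" for L'
      proof -
        have "norm (LINT x|lborel. f x * cis (\<eta> * x + L' * \<Psi> x)) \<le>
            C * (\<bar>L\<bar> powr (- real m) + (\<bar>L\<bar> / Om) powr (- (a - 1 / 2) / \<alpha>) * Om powr (- 1 / 2))"
          using C(2)[OF Om(2) \<eta>, of L'] big that L0 by simp
        also have "\<dots> \<le> C * (real M powr (- real m) * (real n powr (- real m) + real n powr (- q)))"
          by (intro mult_left_mono le C(1))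
        finally show ?thesis by (simp add: B_def mult.assoc)
      qed
      \<comment> \<open>The cosine is the mean of the two modes k = n and k = -n; the oscillatory
        bound depends on |L| only.\<close>
      have "of_real (cos (L * \<Psi> t)) * (of_real (\<mu> t) * G t) =
          (f t * cis (\<eta> * t + L * \<Psi> t) + f t * cis (\<eta> * t + - L * \<Psi> t)) / 2" for t
      proof -
        have "complex_of_real (cos (L * \<Psi> t)) = (cis (L * \<Psi> t) + cis (- L * \<Psi> t)) / 2"
          by (simp add: complex_eq_iff)
        moreover have "cis (\<eta> * t + y) = cis (\<eta> * t) * cis y" for y
          by (simp add: cis_mult)
        ultimately show ?thesis
          unfolding \<mu>G e_def by (simp only: distrib_left times_divide_eq_right times_divide_eq_left mult_ac)
      qed
      hence "(LINT t|lborel. of_real (cos (L * \<Psi> t)) * (of_real (\<mu> t) * G t)) =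
          ((LINT t|lborel. f t * cis (\<eta> * t + L * \<Psi> t)) + (LINT t|lborel. f t * cis (\<eta> * t + - L * \<Psi> t))) / 2"
        by (simp only: integral_divide_zero, subst Bochner_Integration.integral_add)
          (auto intro!: ifc continuous_intros c\<Psi>)
      also have "norm \<dots> \<le> (B n + B n) / 2"
        unfolding norm_divide using L0
        by (intro divide_mono norm_triangle_mono osc) (auto simp: B_def C(1))
      finally show ?thesis by (simp add: L_def)
    qed
    have B0: "B n \<ge> 0" for n using C(1) by (simp add: B_def)
    have sB: "summable B" unfolding B_def by (intro summable_mult sZ)
    have "norm (1 / of_nat M * (\<Sum>j=1..M. G (node \<mu> M j)) - (LINT t|lborel. of_real (\<mu> t) * G t)) \<le> 2 * suminf B"
    proof (rule midpoint_quadrature_error[where \<Psi> = \<Psi> and G' = G'])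
      show "integrable lborel (\<lambda>t. of_real (\<mu> t) * G t)"
        unfolding \<mu>G e_def by (intro ifc continuous_intros)
      show "\<Psi> (node \<mu> M j) = (2 * real j - 1) / (2 * real M)" if "j \<in> {1..M}" for j
        unfolding \<Psi>_def by (rule distr_fun_node[OF \<alpha>(1) c \<mu> that])
    qed (use M(1) distr dG iG' limG jap_tendsto_0 a Bn B0 sB in \<open>auto simp: \<Psi>_def\<close>)
    also have "suminf B = C * real M powr (- real m) * Z"
      unfolding B_def Z_def by (rule suminf_mult[OF sZ])
    finally show ?thesis
      unfolding four appr by (subst norm_minus_commute) (simp add: mult_ac)
  qed
  have "\<forall>\<^sub>F M in sequentially. \<forall>\<xi>. \<bar>\<xi>\<bar> \<le> real M powr (real m / b) \<longrightarrow>
    norm (fourier f \<xi> - approx_ft \<mu> (real M powr (real m / b)) M f \<xi>) \<le> (2 * C * Z) * real M powr (- real m)"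
    using ev by eventually_elim (use main in \<open>auto simp: s_def\<close>)
  then show ?thesis using C(1) Z0 by (intro exI[of _ "2 * C * Z"]) auto
qed

text \<open>Rescaling by R produces the factor R^(1/p), and the remaining profile is integrable
  because b p > 1.\<close>

lemma Lp_error_scaled_bound:
  fixes g h :: "real \<Rightarrow> complex"
  assumes "p \<ge> 1" "b > 1" "R > 0" "E \<ge> 0"
    and [measurable]: "g \<in> borel_measurable borel" "h \<in> borel_measurable borel"
    and bound: "\<And>x. norm (g x - h x) \<le> E * jap (- b) (x / R)"
  shows "Lp_error_finite p g h"
    and "Lp_error p g h \<le> E * R powr (1 / p) * (LINT x|lborel. jap (- b * p) x) powr (1 / p)"
proof -
  have "1 < b * p" using less_le_trans[OF \<open>b > 1\<close>, of "b * p"] assms(1,2) by simp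
  hence bp: "- b * p < - 1" by simp
  define I where "I = (LINT x|lborel. jap (- b * p) x)"
  have I: "I \<ge> 0" unfolding I_def by (intro integral_nonneg_AE) auto
  have i: "integrable lborel (\<lambda>x. E powr p * jap (- b * p) (x / R))"
    using lborel_integrable_real_affine[OF integrable_jap[OF bp], of "1 / R" 0] \<open>R > 0\<close>
    by (intro integrable_mult_right) simp
  have le: "norm (g x - h x) powr p \<le> E powr p * jap (- b * p) (x / R)" for x
  proof -
    have "norm (g x - h x) powr p \<le> (E * jap (- b) (x / R)) powr p"
      using \<open>p \<ge> 1\<close> by (intro powr_mono2 bound) auto
    then show ?thesis by (simp only: powr_mult jap_powr)
  qed
  have int: "integrable lborel (\<lambda>x. norm (g x - h x) powr p)"
    by (rule Bochner_Integration.integrable_bound[OF i]) (use le in \<open>auto intro!: AE_I2 order_trans[OF _ abs_ge_self]\<close>)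
  then show "Lp_error_finite p g h" by (simp add: Lp_error_finite_def)
  have "(LINT x|lborel. norm (g x - h x) powr p) \<le> (LINT x|lborel. E powr p * jap (- b * p) (x / R))"
    by (intro integral_mono int i le)
  also have "\<dots> = E powr p * (R * I)"
    using lborel_integral_real_affine[of "1 / R" "jap (- b * p)" 0] \<open>R > 0\<close>
    by (simp add: I_def)
  finally have "Lp_error p g h \<le> (E powr p * (R * I)) powr (1 / p)"
    unfolding Lp_error_def using \<open>p \<ge> 1\<close> by (intro powr_mono2 integral_nonneg_AE) auto
  also have "\<dots> = E * R powr (1 / p) * I powr (1 / p)"
    using \<open>p \<ge> 1\<close> \<open>E \<ge> 0\<close> by (simp add: powr_mult powr_powr)
  finally show "Lp_error p g h \<le> E * R powr (1 / p) * (LINT x|lborel. jap (- b * p) x) powr (1 / p)"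
    by (simp only: I_def)
qed

text \<open>Within the band the decaying profile stays above 2^(-b/2), so a uniform bound there
  costs only a constant when rewritten with the profile.\<close>

lemma one_le_jap_uminus:
  assumes "b \<ge> 0" "\<bar>y\<bar> \<le> 1"
  shows "1 \<le> 2 powr (b / 2) * jap (- b) y"
proof -
  have "jap (- b) 1 \<le> jap (- b) y" using assms by (intro jap_antimono_abs) auto
  hence "2 powr (b / 2) * jap (- b) 1 \<le> 2 powr (b / 2) * jap (- b) y" by (rule mult_left_mono) simp
  moreover have "2 powr (b / 2) * jap (- b) 1 = 1"
    by (simp add: jap_def powr_add[symmetric])
  ultimately show ?thesis by simp
qed

theorem mainTheorem7:
  fixes a b p \<alpha> :: real and m :: nat
    and v w \<mu> :: "real \<Rightarrow> real" and \<Omega> :: "nat \<Rightarrow> real" and f :: "real \<Rightarrow> complex"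
  assumes "a > 1" and "b > 1"
    and "v = (\<lambda>x. (1 + x\<^sup>2) powr (a / 2))"
    and "w = (\<lambda>\<xi>. (1 + \<xi>\<^sup>2) powr (b / 2))"
    and "2 \<le> m" and "real m < b"
    and "a > 1 / 2 + real m * (2 * b - 1) / (2 * (b - real m))"
    and "f \<in> space_Fm v m" and "fourier f \<in> space_F w"
    and "p \<ge> 1"
    and "\<alpha> = 2 * (b - real m) * (a - 1 / 2) / (real m * (2 * b - 1))"
    and "\<mu> = (\<lambda>x. C_const \<alpha> * (1 + x\<^sup>2) powr (- \<alpha> / 2))"
    and "\<Omega> = (\<lambda>M. real M powr (real m / b))"
  shows "(\<forall>\<^sub>F M in sequentially. Lp_error_finite p (fourier f) (approx_ft \<mu> (\<Omega> M) M f)) \<and>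
         (\<lambda>M. Lp_error p (fourier f) (approx_ft \<mu> (\<Omega> M) M f))
           \<in> O(\<lambda>M. real M powr (- real m + real m / (p * b)))"
proof -
  note b = \<open>b > 1\<close> and m = \<open>2 \<le> m\<close> and mb = \<open>real m < b\<close> and p = \<open>p \<ge> 1\<close> and \<Omega> = assms(13)
  have m0: "real m > 0" using m by simp
  have v: "v = jap a" and w: "w = jap b"
    using assms(3,4) by (auto simp: fun_eq_iff jap_def)
  define c where "c = C_const \<alpha>"
  have \<mu>: "\<mu> = (\<lambda>x. c * jap (- \<alpha>) x)"
    using assms(12) by (auto simp: fun_eq_iff jap_def c_def)
  \<comment> \<open>The value of (a - 1/2)/\<alpha> that solves \<open>rate\<close>; the hypothesis
    on a reads a - 1/2 > q, which is \<alpha> > 1.\<close>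
  define q where "q = real m * (2 * b - 1) / (2 * (b - real m))"
  have q: "q > 0" using m0 mb b by (simp add: q_def)
  have aq: "a - 1 / 2 > q" using assms(7) by (simp add: q_def)
  have \<alpha>q: "\<alpha> = (a - 1 / 2) / q" using assms(11) by (simp add: q_def mult_ac)
  have \<alpha>1: "\<alpha> > 1" using aq q by (simp add: \<alpha>q)
  \<comment> \<open>This amounts to 2 (b - m) < 2 b - 1. Multiplied by \<alpha>, it gives the
    integrability condition \<alpha> m < a - 1/2.\<close>
  have mq: "real m < q"
  proof -
    have "real m * (2 * (b - real m)) < real m * (2 * b - 1)" using m m0 by (intro mult_strict_left_mono) auto
    then show ?thesis using mb by (simp add: q_def pos_less_divide_eq)
  qed
  have \<alpha>2: "\<alpha> * real m < a - 1 / 2"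
  proof -
    have "(a - 1 / 2) * real m < (a - 1 / 2) * q" using mq aq q by (intro mult_strict_left_mono) auto
    then show ?thesis using q by (simp add: \<alpha>q pos_divide_less_eq)
  qed
  have "(a - 1 / 2) / \<alpha> = q" using aq q by (simp add: \<alpha>q)
  moreover have "(1 - real m / b) * q = real m * (2 * b - 1) / (2 * b)"
    using mb b by (simp add: q_def field_simps)
  moreover have "real m * (2 * b - 1) / (2 * b) + real m / (2 * b) = real m"
    using b by (simp add: field_simps)
  ultimately have rate: "(1 - real m / b) * ((a - 1 / 2) / \<alpha>) + real m / (2 * b) = real m"
    by simp
  have f: "f \<in> space_Fm (jap a) m" and g: "fourier f \<in> space_F (jap b)"
    using assms(8,9) by (auto simp: v w)
  obtain C where C: "C \<ge> 0" and ev: "\<forall>\<^sub>F M in sequentially. \<forall>\<xi>. \<bar>\<xi>\<bar> \<le> real M powr (real m / b) \<longrightarrow>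
    norm (fourier f \<xi> - approx_ft \<mu> (real M powr (real m / b)) M f \<xi>) \<le> C * real M powr (- real m)"
    using sup_error_bound[OF m mb b f \<alpha>1 \<alpha>2 rate] C_const_times_integral_jap[OF \<alpha>1] \<mu>
    unfolding c_def by blast
  obtain N where N: "N \<ge> 0" "\<And>\<xi>. norm (fourier f \<xi>) \<le> N * jap (- b) \<xi>" and cg: "continuous_on UNIV (fourier f)"
    using space_F_bound[OF g] by blast
  have mg [measurable]: "fourier f \<in> borel_measurable borel"
    by (rule borel_measurable_continuous_onI[OF cg])
  have mh [measurable]: "approx_ft \<mu> R M f \<in> borel_measurable borel" for R M
  proof -
    have "continuous_on UNIV (\<lambda>\<xi>. 1 / of_nat M * (\<Sum>j=1..M. f (node \<mu> M j) / of_real (\<mu> (node \<mu> M j))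
          * exp (- (2 * of_real pi * \<i> * of_real \<xi> * of_real (node \<mu> M j)))))"
      by (intro continuous_intros)
    from borel_measurable_continuous_onI[OF this] show ?thesis
      unfolding approx_ft_def [abs_def] by measurable
  qed
  define K where "K = (C + N) * 2 powr (b / 2)"
  have K: "K \<ge> 0" using C N by (simp add: K_def)
  define I where "I = (LINT x|lborel. jap (- b * p) x) powr (1 / p)"
  have main: "\<forall>\<^sub>F M in sequentially. Lp_error_finite p (fourier f) (approx_ft \<mu> (\<Omega> M) M f) \<and>
      Lp_error p (fourier f) (approx_ft \<mu> (\<Omega> M) M f) \<le> (K * I) * real M powr (- real m + real m / (p * b))"
    using ev eventually_ge_at_top[of 1]
  proof eventually_elim
    case (elim M)
    define R where "R = real M powr (real m / b)"
    have M0: "real M > 0" using elim by simp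
    have R0: "R > 0" using M0 by (simp add: R_def)
    have Rb: "R powr (- b) = real M powr (- real m)" using b by (simp add: R_def powr_powr)
    have bound: "norm (fourier f \<xi> - approx_ft \<mu> R M f \<xi>) \<le> (K * real M powr (- real m)) * jap (- b) (\<xi> / R)" for \<xi>
    proof (cases "\<bar>\<xi>\<bar> \<le> R")
      case True
      have "norm (fourier f \<xi> - approx_ft \<mu> R M f \<xi>) \<le> C * real M powr (- real m) * 1"
        using elim True by (simp add: R_def)
      also have "\<dots> \<le> (C + N) * real M powr (- real m) * (2 powr (b / 2) * jap (- b) (\<xi> / R))"
        by (intro mult_mono one_le_jap_uminus) (use C N b R0 True in \<open>auto simp: abs_divide\<close>)
      finally show ?thesis by (simp add: K_def mult_ac)
    next
      case False
      hence x: "\<bar>\<xi>\<bar> > R" by simp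
      have "norm (fourier f \<xi> - approx_ft \<mu> R M f \<xi>) \<le> N * jap (- b) \<xi>"
        using N(2)[of \<xi>] x by (simp add: approx_ft_def)
      also have "\<dots> \<le> N * \<bar>\<xi>\<bar> powr (- b)"
        by (intro mult_left_mono jap_le_powr) (use N b x R0 in auto)
      also have "\<bar>\<xi>\<bar> powr (- b) = real M powr (- real m) * \<bar>\<xi> / R\<bar> powr (- b)"
        unfolding Rb[symmetric] powr_mult[symmetric] using R0 by (simp add: abs_divide)
      \<comment> \<open>Outside the band |\<xi> / R| \<ge> 1, so the pure power is at most 2^(b/2)
        times the profile, the same constant as inside.\<close>
      also have "N * \<dots> \<le> (C + N) * (real M powr (- real m) * (2 powr (- (- b) / 2) * jap (- b) (\<xi> / R)))"
        by (intro mult_mono powr_le_jap) (use C N b R0 x in \<open>auto simp: abs_divide\<close>)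
      finally show ?thesis by (simp add: K_def mult_ac)
    qed
    have E0: "K * real M powr (- real m) \<ge> 0" using K by simp
    note L = Lp_error_scaled_bound[OF p b R0 E0 mg mh bound]
    have "R powr (1 / p) = real M powr (real m / (p * b))"
      using p b by (simp add: R_def powr_powr mult.commute)
    hence "Lp_error p (fourier f) (approx_ft \<mu> R M f) \<le> (K * I) * real M powr (- real m + real m / (p * b))"
      using L(2) unfolding powr_add I_def by (simp only: mult_ac)
    with L(1) show ?case by (simp only: R_def \<Omega>)
  qed
  have Lp0: "Lp_error p (fourier f) h \<ge> 0" for h by (simp add: Lp_error_def)
  show ?thesis
  proof
    show "\<forall>\<^sub>F M in sequentially. Lp_error_finite p (fourier f) (approx_ft \<mu> (\<Omega> M) M f)"
      using main by (rule eventually_mono) simp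
    show "(\<lambda>M. Lp_error p (fourier f) (approx_ft \<mu> (\<Omega> M) M f)) \<in> O(\<lambda>M. real M powr (- real m + real m / (p * b)))"
      by (rule bigoI[where c = "K * I"]) (use main in eventually_elim, use Lp0 in simp)
  qed
qed

end
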